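(* Let $G'$ be a nilpotent group of odd order having no Sylow subgroup which is cyclic (possibly $G'$ is trivial). If $G\cong G'\times P\times\mathbb{Z}_n$, where $P$ is a finite non-cyclic $2$-group, $n$ is a positive integer, and $\gcd(n,|G'|)=\gcd(2,n)=1$, then $\lambda(\mathcal{P}_E(G))=|G|+|\mathrm{Dom}(\mathcal{P}_E(G))|-1$.
   Context: The enhanced power graph $\mathcal{P}_E(G)$ of a finite group $G$ is the simple undirected graph with vertex set $G$ in which two distinct vertices $x,y$ are adjacent if there is $z\in G$ with $x,y\in\langle z\rangle$. $\mathrm{Dom}(\Gamma)$ is the set of dominating vertices of a graph $\Gamma$, i.e. vertices adjacent to all other vertices. $\mathbb{Z}_n$ is the cyclic group of order $n$. "No Sylow subgroup which is cyclic" means that for every prime $p$ dividing $|G'|$ the Sylow $p$-subgroup of $G'$ is non-cyclic. An $L(2,1)$-labeling of a finite graph $\Gamma$ is an integer-valued function $f$ on $V(\Gamma)$ such that $|f(u)-f(v)|\geq 2$ whenever $u,v$ are adjacent and $|f(u)-f(v)|\geq 1$ whenever $u,v$ are at distance $2$. Its span is the difference between the maximum and the minimum of $f$. The $\lambda$-number $\lambda(\Gamma)$ is the minimum span over all $L(2,1)$-labelings of $\Gamma$. *)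

theory Defs
  imports
    "HOL-Algebra.Elementary_Groups"
    "HOL-Computational_Algebra.Primes"
    "Graph_Theory.Pair_Digraph"
    "Graph_Theory.Shortest_Path"
begin

primrec lower_central_series :: "('a, 'b) monoid_scheme \<Rightarrow> nat \<Rightarrow> 'a set" where
  "lower_central_series G 0 = carrier G"
| "lower_central_series G (Suc i) =
     generate G (\<Union>x \<in> lower_central_series G i. \<Union>y \<in> carrier G.
       {x \<otimes>\<^bsub>G\<^esub> y \<otimes>\<^bsub>G\<^esub> inv\<^bsub>G\<^esub> x \<otimes>\<^bsub>G\<^esub> inv\<^bsub>G\<^esub> y})"

definition nilpotent_group :: "('a, 'b) monoid_scheme \<Rightarrow> bool" where
  "nilpotent_group G \<longleftrightarrow> group G \<and> (\<exists>c. lower_central_series G c = {\<one>\<^bsub>G\<^esub>})"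

definition finite_p_group :: "nat \<Rightarrow> ('a, 'b) monoid_scheme \<Rightarrow> bool" where
  "finite_p_group p G \<longleftrightarrow> group G \<and> finite (carrier G) \<and> (\<exists>k. order G = p ^ k)"

text \<open>Only meaningful for a finite group \<open>G\<close> and a prime \<open>p\<close>.\<close>

definition sylow_subgroup :: "nat \<Rightarrow> 'a set \<Rightarrow> ('a, 'b) monoid_scheme \<Rightarrow> bool" where
  "sylow_subgroup p H G \<longleftrightarrow> subgroup H G \<and> card H = p ^ multiplicity p (order G)"

definition no_cyclic_sylow :: "'a monoid \<Rightarrow> bool" where
  "no_cyclic_sylow G \<longleftrightarrow>
     (\<forall>p H. prime p \<and> p dvd order G \<and> sylow_subgroup p H G
        \<longrightarrow> \<not> cyclic_group (G\<lparr>carrier := H\<rparr>))"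

text \<open>
  A finite simple undirected graph is a \<^locale>\<open>pair_graph\<close>: finite, loop-free, and each edge is
  represented by its two arcs. The distance is the least number of arcs of a walk, which is
  infinite if there is no walk.
\<close>

definition graph_dist :: "'a pair_pre_digraph \<Rightarrow> 'a \<Rightarrow> 'a \<Rightarrow> ereal" where
  "graph_dist \<Gamma> u v = wf_digraph.\<mu> (with_proj \<Gamma>) (\<lambda>_. 1) u v"

definition Dom :: "'a pair_pre_digraph \<Rightarrow> 'a set" where
  "Dom \<Gamma> = {v \<in> pverts \<Gamma>. \<forall>w \<in> pverts \<Gamma>. w \<noteq> v \<longrightarrow> (v, w) \<in> parcs \<Gamma>}"

definition L21_labeling :: "'a pair_pre_digraph \<Rightarrow> ('a \<Rightarrow> int) \<Rightarrow> bool" where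
  "L21_labeling \<Gamma> f \<longleftrightarrow>
     (\<forall>u \<in> pverts \<Gamma>. \<forall>v \<in> pverts \<Gamma>.
        ((u, v) \<in> parcs \<Gamma> \<longrightarrow> \<bar>f u - f v\<bar> \<ge> 2) \<and>
        (graph_dist \<Gamma> u v = 2 \<longrightarrow> \<bar>f u - f v\<bar> \<ge> 1))"

definition labeling_span :: "'a pair_pre_digraph \<Rightarrow> ('a \<Rightarrow> int) \<Rightarrow> int" where
  "labeling_span \<Gamma> f = Max (f ` pverts \<Gamma>) - Min (f ` pverts \<Gamma>)"

definition lambda_number :: "'a pair_pre_digraph \<Rightarrow> int" where
  "lambda_number \<Gamma> = (LEAST s. \<exists>f. L21_labeling \<Gamma> f \<and> labeling_span \<Gamma> f = s)"

definition enhanced_power_graph :: "('a, 'b) monoid_scheme \<Rightarrow> 'a pair_pre_digraph" where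
  "enhanced_power_graph G =
     \<lparr> pverts = carrier G,
       parcs = {(x, y). x \<in> carrier G \<and> y \<in> carrier G \<and> x \<noteq> y \<and>
                  (\<exists>z \<in> carrier G. x \<in> generate G {z} \<and> y \<in> generate G {z})} \<rparr>"

lemma pair_graph_enhanced_power_graph:
  assumes "finite (carrier G)"
  shows "pair_graph (enhanced_power_graph G)"
proof
  show "finite (parcs (enhanced_power_graph G))"
    by (rule finite_subset[of _ "carrier G \<times> carrier G"])
       (use assms in \<open>auto simp: enhanced_power_graph_def\<close>)
  show "symmetric (with_proj (enhanced_power_graph G))"
    by (auto simp: symmetric_def arcs_ends_def arc_to_ends_def enhanced_power_graph_def intro!: symI)
qed (use assms in \<open>auto simp: enhanced_power_graph_def\<close>)

end

theory Submission
  imports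
    Defs
    "HOL-Algebra.Multiplicative_Group"
    "HOL-Number_Theory.Cong"
begin

text \<open>
  The enhanced power graph \<open>\<Gamma>\<close> of a group has the identity as a dominating vertex, so its diameter is
  at most 2, and an \<open>L(2,1)\<close>-labeling is the same as an injective labeling that separates adjacent
  vertices by at least 2. Each dominating vertex then costs one additional label, and if a
  non-dominating vertex exists, the span is at least \<open>|G| + |Dom \<Gamma>| - 1\<close> (\<open>labeling_span_ge\<close>). This
  value is attained if the complement of \<open>\<Gamma>\<close>, restricted to the non-dominating vertices, has a
  Hamiltonian path: label along the path with consecutive integers and give every second integer
  after that to a dominating vertex (\<open>labeling_from_path\<close>).

  The restricted complement even has a Hamiltonian cycle, by the degree condition of Posa
  (\<open>posa_hamiltonian_cycle\<close>). It requires that for each \<open>k\<close> less than half the number of vertices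
  there are either none or fewer than \<open>k\<close> vertices of complement degree at most \<open>k\<close>. Let \<open>S\<close> be the set of
  all group elements of complement degree at most \<open>k < |G| / 2\<close>. Their closed
  neighbourhoods in \<open>\<Gamma>\<close> contain more than half of the group, hence they are central. For a prime \<open>p\<close>, their \<open>p\<close>-parts are also in \<open>S\<close>, and each of
  these \<open>p\<close>-elements is a power of at least half of the group elements (\<open>half_above\<close>). Since the
  identity has no powers but itself, it follows by counting that any two of them are powers of a
  common element and hence one is a power of the other (\<open>few_apart_comparable\<close>), so that the \<open>p\<close>-parts of
  \<open>S\<close> all lie in the cyclic subgroup generated by one of them, \<open>c\<close>. If \<open>S\<close> has a non-dominating
  element, then \<open>p\<close> can be chosen such that \<open>c\<close> is not dominating (\<open>exists_nondominating_p_part\<close>).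
  The set of all elements whose \<open>p\<close>-part is a power of \<open>c\<close> contains \<open>S\<close>, and translation by a \<open>p\<close>-element
  that shares no cyclic subgroup with \<open>c\<close> maps it into the complement neighbourhood of \<open>c\<close>, which has
  at most \<open>k\<close> elements (\<open>card_few_apart_le\<close>). Since \<open>S\<close> contains the identity, fewer than \<open>k\<close> elements
  of \<open>S\<close> are not dominating.

  Nilpotency enters through the fact that elements of coprime order commute, which passes to the
  product of \<open>G'\<close>, \<open>P\<close> and \<open>\<int>\<^sub>n\<close>. Because \<open>P\<close> is not cyclic, neither is \<open>G\<close>, which provides a
  non-dominating vertex.
\<close>

section \<open>Hamiltonian cycles from degree conditions\<close>

text \<open>
  The number of neighbours of \<open>x\<close> in \<open>V\<close>, for a symmetric relation \<open>R\<close> read as adjacency.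
\<close>

definition degree_in :: "'a set \<Rightarrow> ('a \<Rightarrow> 'a \<Rightarrow> bool) \<Rightarrow> 'a \<Rightarrow> nat" where
  "degree_in V R x = card {y \<in> V. R x y}"

text \<open>
  A Hamiltonian path \<open>g 0, \<dots>, g (m - 1)\<close> closes up to a Hamiltonian cycle as soon as there are
  crossing chords \<open>g 0 - g (i + 1)\<close> and \<open>g (m - 1) - g i\<close>: follow the path up to \<open>g i\<close>, jump to
  the last vertex, and run back to \<open>g (i + 1)\<close>.
\<close>

lemma cycle_from_crossing:
  fixes g :: "nat \<Rightarrow> 'a"
  assumes sym: "\<And>x y. R x y \<Longrightarrow> R y x"
    and g: "bij_betw g {..<m} V" "\<And>j. Suc j < m \<Longrightarrow> R (g j) (g (Suc j))"
    and i: "Suc i < m" "R (g 0) (g (Suc i))" "R (g (m - 1)) (g i)"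
  shows "\<exists>h. bij_betw h {..<m} V \<and> (\<forall>j<m. R (h j) (h (Suc j mod m)))"
proof -
  define s where "s j = (if j \<le> i then j else m + i - j)" for j
  have "bij_betw s {..<m} {..<m}"
    by (rule bij_betw_byWitness[where f' = s]) (use i in \<open>auto simp: s_def\<close>)
  then have "bij_betw (g \<circ> s) {..<m} V" using g(1) by (rule bij_betw_trans)
  moreover have "R ((g \<circ> s) j) ((g \<circ> s) (Suc j mod m))" if j: "j < m" for j
  proof -
    consider "j < i" | "j = i" | "i < j" "Suc j < m" | "i < j" "Suc j = m"
      using j by linarith
    then show ?thesis
    proof cases
      case 1
      then show ?thesis using g(2)[of j] i by (simp add: s_def)
    next
      case 2
      then show ?thesis using sym[OF i(3)] i by (simp add: s_def)
    next
      case 3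
      then have "Suc (m + i - Suc j) = m + i - j" by simp
      then show ?thesis using 3 sym[OF g(2)[of "m + i - Suc j"]] by (simp add: s_def)
    next
      case 4
      then have "m + i - j = Suc i" by simp
      then show ?thesis using 4 sym[OF i(2)] by (simp add: s_def)
    qed
  qed
  ultimately show ?thesis by blast
qed

text \<open>
  If \<open>R'\<close> exceeds \<open>R\<close> by at most the edge \<open>uv\<close>, and a Hamiltonian cycle of \<open>R'\<close> does use that
  edge, then cutting the cycle there leaves a Hamiltonian path of \<open>R\<close> from \<open>u\<close> to \<open>v\<close>.
\<close>

lemma cycle_open_at:
  fixes h :: "nat \<Rightarrow> 'a"
  assumes m: "3 \<le> m" and h: "bij_betw h {..<m} V"
    and cyc: "\<And>j. j < m \<Longrightarrow> R' (h j) (h (Suc j mod m))"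
    and new: "\<And>x y. R' x y \<Longrightarrow> \<not> R x y \<Longrightarrow> {x, y} = {u, v}"
    and sym: "\<And>x y. R x y \<Longrightarrow> R y x"
    and i: "i < m" "\<not> R (h i) (h (Suc i mod m))"
  shows "\<exists>g. bij_betw g {..<m} V \<and> (\<forall>j. Suc j < m \<longrightarrow> R (g j) (g (Suc j))) \<and> g 0 = u \<and> g (m - 1) = v"
proof -
  \<comment> \<open>rotation that makes the cut edge the one between the last and the first vertex\<close>
  define t where "t j = (Suc i + j) mod m" for j
  have "inj_on t {..<m}"
  proof (rule inj_onI)
    fix a b assume ab: "a \<in> {..<m}" "b \<in> {..<m}" "t a = t b"
    have le: "a = b" if "a \<le> b" "b < m" "t a = t b" for a b
    proof -
      have "m dvd (Suc i + b) - (Suc i + a)"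
        using that by (metis t_def mod_eq_dvd_iff_nat add_le_cancel_left)
      then have "m dvd b - a" by simp
      then show ?thesis using that by (meson dvd_imp_le less_imp_diff_less not_less zero_less_diff nle_le le_antisym)
    qed
    show "a = b" using le[of a b] le[of b a] ab by (metis lessThan_iff nle_le)
  qed
  moreover have "t ` {..<m} \<subseteq> {..<m}" using m by (auto simp: t_def)
  ultimately have t: "bij_betw t {..<m} {..<m}"
    by (simp add: bij_betw_def endo_inj_surj)
  define g where "g = h \<circ> t"
  have g: "bij_betw g {..<m} V" unfolding g_def using t h by (rule bij_betw_trans)
  have ends: "g 0 = h (Suc i mod m)" "g (m - 1) = h i"
    using m i by (auto simp: g_def t_def)
  then have uv: "{g (m - 1), g 0} = {u, v}" using new cyc i by metis
  have step: "R (g j) (g (Suc j))" if j: "Suc j < m" for j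
  proof (rule ccontr)
    assume not: "\<not> R (g j) (g (Suc j))"
    have "R' (g j) (g (Suc j))"
      using cyc[of "t j"] m by (simp add: g_def t_def mod_Suc_eq)
    then have "{g j, g (Suc j)} = {g (m - 1), g 0}" using new not uv by metis
    moreover have "inj_on g {..<m}" using g by (simp add: bij_betw_def)
    ultimately have "{j, Suc j} = {m - 1, 0}"
      using j m by (auto simp: doubleton_eq_iff dest: inj_onD)
    then show False using m by (auto simp: doubleton_eq_iff)
  qed
  show ?thesis
  proof (cases "g 0 = u")
    case True
    then show ?thesis using g step uv by (metis doubleton_eq_iff)
  next
    case False
    define g' where "g' = g \<circ> (\<lambda>j. m - 1 - j)"
    have "bij_betw (\<lambda>j. m - 1 - j) {..<m} {..<m}"
      by (rule bij_betw_byWitness[where f' = "\<lambda>j. m - 1 - j"]) auto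
    then have "bij_betw g' {..<m} V" unfolding g'_def using g by (rule bij_betw_trans)
    moreover have "R (g' j) (g' (Suc j))" if j: "Suc j < m" for j
    proof -
      have "Suc (m - 1 - Suc j) = m - 1 - j" using j by simp
      then show ?thesis using sym[OF step[of "m - 1 - Suc j"]] j by (simp add: g'_def)
    qed
    moreover have "g' 0 = u" "g' (m - 1) = v"
      using False uv by (auto simp: g'_def doubleton_eq_iff)
    ultimately show ?thesis by blast
  qed
qed

text \<open>
  Posa's theorem. The degree condition reads: for every \<open>k < m / 2\<close>, the number of vertices of
  degree at most \<open>k\<close> is zero or smaller than \<open>k\<close>. It survives the addition of edges, so one may
  argue by induction on the number of non-edges: add a missing edge \<open>uv\<close> with \<open>d u + d v\<close> maximal,
  take a Hamiltonian cycle of the larger graph, and remove the edge again by means of crossing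
  chords.
\<close>

theorem posa_hamiltonian_cycle:
  fixes V :: "'a set"
  assumes "finite V" "3 \<le> card V"
    and "\<And>x y. R x y \<Longrightarrow> R y x" "\<And>x. \<not> R x x"
    and "\<And>x k. \<lbrakk>x \<in> V; degree_in V R x \<le> k; 2 * k < card V\<rbrakk>
           \<Longrightarrow> card {y \<in> V. degree_in V R y \<le> k} < k"
  shows "\<exists>h. bij_betw h {..<card V} V \<and> (\<forall>j<card V. R (h j) (h (Suc j mod card V)))"
  using assms(3-)
proof (induction "card {(x, y). x \<in> V \<and> y \<in> V \<and> x \<noteq> y \<and> \<not> R x y}" arbitrary: R rule: less_induct)
  case less
  note sym = less.prems(1) and irr = less.prems(2) and few = less.prems(3)
  let ?m = "card V" and ?d = "degree_in V R"
  let ?N = "\<lambda>R. {(x, y). x \<in> V \<and> y \<in> V \<and> x \<noteq> y \<and> \<not> R x y}"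
  have finN: "finite (?N R)" for R
    by (rule finite_subset[of _ "V \<times> V"]) (use assms(1) in auto)
  show ?case
  proof (cases "?N R = {}")
    case True
    obtain h where h: "bij_betw h {..<?m} V"
      using ex_bij_betw_nat_finite[OF assms(1)] by (auto simp: atLeast0LessThan)
    have "R (h j) (h (Suc j mod ?m))" if j: "j < ?m" for j
    proof -
      have "Suc j mod ?m < ?m" "Suc j mod ?m \<noteq> j" using assms(2) j by (auto simp: mod_Suc)
      then have "h j \<noteq> h (Suc j mod ?m)" "h j \<in> V" "h (Suc j mod ?m) \<in> V"
        using h j by (auto simp: bij_betw_def dest: inj_onD)
      then show ?thesis using True by blast
    qed
    then show ?thesis using h by blast
  next
    case False
    have "finite ((\<lambda>(x, y). ?d x + ?d y) ` ?N R)" "(\<lambda>(x, y). ?d x + ?d y) ` ?N R \<noteq> {}"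
      using finN[of R] False by auto
    from Max_in[OF this] obtain u0 v0 where uv0: "u0 \<in> V" "v0 \<in> V" "u0 \<noteq> v0" "\<not> R u0 v0"
      "?d u0 + ?d v0 = Max ((\<lambda>(x, y). ?d x + ?d y) ` ?N R)" by auto
    have max0: "?d x + ?d y \<le> ?d u0 + ?d v0" if "x \<in> V" "y \<in> V" "x \<noteq> y" "\<not> R x y" for x y
      unfolding uv0(5) using finN[of R] that by (intro Max_ge) auto
    obtain u v where uv: "u \<in> V" "v \<in> V" "u \<noteq> v" "\<not> R u v" "?d u \<le> ?d v"
      and max: "\<And>x y. \<lbrakk>x \<in> V; y \<in> V; x \<noteq> y; \<not> R x y\<rbrakk> \<Longrightarrow> ?d x + ?d y \<le> ?d u + ?d v"
    proof (cases "?d u0 \<le> ?d v0")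
      case True
      then show ?thesis using that[of u0 v0] uv0 max0 by blast
    next
      case False
      have "\<not> R v0 u0" using uv0 sym by blast
      moreover have "?d x + ?d y \<le> ?d v0 + ?d u0" if "x \<in> V" "y \<in> V" "x \<noteq> y" "\<not> R x y" for x y
        using max0[OF that] by simp
      ultimately show ?thesis using that[of v0 u0] uv0 False by force
    qed
    define R' where "R' x y \<longleftrightarrow> R x y \<or> {x, y} = {u, v}" for x y
    have deg_le: "?d x \<le> degree_in V R' x" for x
      unfolding degree_in_def by (rule card_mono) (use assms(1) in \<open>auto simp: R'_def\<close>)
    have "?N R' \<subset> ?N R"
    proof
      show "?N R' \<subseteq> ?N R" by (auto simp: R'_def)
      have "(u, v) \<in> ?N R" "(u, v) \<notin> ?N R'" using uv by (auto simp: R'_def)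
      then show "?N R' \<noteq> ?N R" by blast
    qed
    then have "card (?N R') < card (?N R)" by (rule psubset_card_mono[OF finN])
    then have "\<exists>h. bij_betw h {..<?m} V \<and> (\<forall>j<?m. R' (h j) (h (Suc j mod ?m)))"
    proof (rule less.hyps)
      fix x y assume "R' x y" then show "R' y x" using sym by (auto simp: R'_def)
    next
      fix x show "\<not> R' x x" using irr uv by (auto simp: R'_def)
    next
      fix x k assume x: "x \<in> V" "degree_in V R' x \<le> k" "2 * k < ?m"
      have "card {y \<in> V. degree_in V R' y \<le> k} \<le> card {y \<in> V. ?d y \<le> k}"
        using assms(1) by (intro card_mono) (auto intro: le_trans[OF deg_le])
      also have "\<dots> < k" using few[of x k] x deg_le[of x] by simp
      finally show "card {y \<in> V. degree_in V R' y \<le> k} < k" .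
    qed
    then obtain h where h: "bij_betw h {..<?m} V" "\<And>j. j < ?m \<Longrightarrow> R' (h j) (h (Suc j mod ?m))"
      by blast
    show ?thesis
    proof (cases "\<forall>j<?m. R (h j) (h (Suc j mod ?m))")
      case True
      then show ?thesis using h by blast
    next
      case False
      then obtain i where i: "i < ?m" "\<not> R (h i) (h (Suc i mod ?m))" by blast
      have new: "R' x y \<Longrightarrow> \<not> R x y \<Longrightarrow> {x, y} = {u, v}" for x y by (auto simp: R'_def)
      obtain g where g: "bij_betw g {..<?m} V" "\<And>j. Suc j < ?m \<Longrightarrow> R (g j) (g (Suc j))"
        "g 0 = u" "g (?m - 1) = v"
        using cycle_open_at[where R' = R' and R = R, OF assms(2) h new sym i] by blast
      have inj: "inj_on g {..<?m}" and im: "g ` {..<?m} = V" using g(1) by (auto simp: bij_betw_def)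
      define A where "A = {i. Suc i < ?m \<and> R u (g (Suc i))}"
      have A: "A \<subseteq> {..<?m}" "finite A"
        by (auto simp: A_def intro: finite_subset[of _ "{..<?m}"])
      have "bij_betw (\<lambda>i. g (Suc i)) A {y \<in> V. R u y}"
      proof (rule bij_betw_imageI)
        show "inj_on (\<lambda>i. g (Suc i)) A"
          using inj by (auto simp: inj_on_def A_def)
        show "(\<lambda>i. g (Suc i)) ` A = {y \<in> V. R u y}"
        proof (intro equalityI subsetI)
          fix y assume "y \<in> (\<lambda>i. g (Suc i)) ` A"
          then show "y \<in> {y \<in> V. R u y}" using im by (auto simp: A_def)
        next
          fix y assume y: "y \<in> {y \<in> V. R u y}"
          then obtain j where j: "j < ?m" "y = g j" using im by auto
          then have "j \<noteq> 0" using y irr g(3) by (metis mem_Collect_eq)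
          then obtain j' where "j = Suc j'" using not0_implies_Suc by blast
          then show "y \<in> (\<lambda>i. g (Suc i)) ` A" using j y by (auto simp: A_def)
        qed
      qed
      then have "card A = ?d u" by (simp add: degree_in_def bij_betw_same_card)
      moreover have "card (g ` A) = card A"
        using inj A by (intro card_image) (blast intro: inj_on_subset)
      ultimately have cA: "card (g ` A) = ?d u" by simp
      \<comment> \<open>Otherwise the predecessors on the path of the neighbours of \<open>u\<close> are \<open>d u\<close> vertices not adjacent
        to \<open>v\<close>. By the choice of \<open>u\<close> and \<open>v\<close> all of them have degree at most \<open>d u < m / 2\<close>,
        which contradicts the degree condition.\<close>
      have "\<exists>i. Suc i < ?m \<and> R u (g (Suc i)) \<and> R v (g i)"
      proof (rule ccontr)
        assume "\<not> ?thesis"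
        then have no: "\<not> R v (g i)" if "i \<in> A" for i using that by (auto simp: A_def)
        have ne: "g i \<noteq> v" "g i \<in> V" if "i \<in> A" for i
        proof -
          have "i < ?m" "i \<noteq> ?m - 1" using that by (auto simp: A_def)
          then show "g i \<noteq> v" "g i \<in> V" using inj g(4) im by (auto dest: inj_onD)
        qed
        have "{y \<in> V. R v y} \<subseteq> V - insert v (g ` A)" using no irr by auto
        then have "?d v \<le> card (V - insert v (g ` A))"
          unfolding degree_in_def using assms(1) by (intro card_mono) auto
        also have "\<dots> = ?m - card (insert v (g ` A))"
          using uv ne A by (intro card_Diff_subset) auto
        also have "card (insert v (g ` A)) = Suc (?d u)"
          using ne A cA by (subst card_insert_disjoint) auto
        finally have "2 * ?d u < ?m" using uv(5) assms(2) by linarith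
        from few[OF uv(1) le_refl this]
        have "card {y \<in> V. ?d y \<le> ?d u} < ?d u" .
        moreover have "g ` A \<subseteq> {y \<in> V. ?d y \<le> ?d u}"
        proof
          fix y assume "y \<in> g ` A"
          then obtain i where i: "i \<in> A" "y = g i" by auto
          then have "?d v + ?d y \<le> ?d u + ?d v"
            using max[OF uv(2) ne(2)] ne(1) no by metis
          then show "y \<in> {y \<in> V. ?d y \<le> ?d u}" using ne i by simp
        qed
        then have "card (g ` A) \<le> card {y \<in> V. ?d y \<le> ?d u}"
          using assms(1) by (intro card_mono) auto
        ultimately show False using cA by simp
      qed
      then obtain i where "Suc i < ?m" "R (g 0) (g (Suc i))" "R (g (?m - 1)) (g i)"
        using g by auto
      then show ?thesis using cycle_from_crossing[where R = R, OF sym g(1,2)] by blast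
    qed
  qed
qed

section \<open>Labelings of graphs with a dominating vertex\<close>

lemma graph_dist_refl:
  assumes "pair_graph \<Gamma>" "u \<in> pverts \<Gamma>"
  shows "graph_dist \<Gamma> u u \<le> 0"
proof -
  interpret pair_graph \<Gamma> by (rule assms(1))
  have "awalk u [] u" using assms(2) by (simp add: awalk_Nil_iff)
  from min_cost_le_walk_cost[OF this, of "\<lambda>_. 1"] show ?thesis
    by (simp add: graph_dist_def zero_ereal_def)
qed

text \<open>
  A dominating vertex bounds all distances by 2, so that a labeling is injective.
\<close>

lemma graph_dist_eq_2:
  assumes "pair_graph \<Gamma>" "w \<in> Dom \<Gamma>" "u \<in> pverts \<Gamma>" "v \<in> pverts \<Gamma>" "u \<noteq> v" "(u, v) \<notin> parcs \<Gamma>"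
  shows "graph_dist \<Gamma> u v = 2"
proof -
  interpret pair_graph \<Gamma> by (rule assms(1))
  have sym: "(y, x) \<in> parcs \<Gamma>" if "(x, y) \<in> parcs \<Gamma>" for x y
    using that arcs_symmetric by blast
  have "w \<noteq> u" "w \<noteq> v" using assms sym by (auto simp: Dom_def)
  then have "(u, w) \<in> parcs \<Gamma>" "(w, v) \<in> parcs \<Gamma>" using assms sym by (auto simp: Dom_def)
  then have "awalk u [(u, w), (w, v)] v"
    using assms by (simp add: awalk_Cons_iff awalk_Nil_iff)
  from min_cost_le_walk_cost[OF this, of "\<lambda>_. 1"] have "graph_dist \<Gamma> u v \<le> 2"
    by (simp add: graph_dist_def)
  moreover have "2 \<le> graph_dist \<Gamma> u v"
    unfolding graph_dist_def \<mu>_def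
  proof (rule INF_greatest)
    fix q assume "q \<in> {q. awalk u q v}"
    then have q: "awalk u q v" by simp
    have cost: "awalk_cost (\<lambda>_. 1) q = real (length q)" for q :: "('a \<times> 'a) list"
      by (induction q) auto
    have "q \<noteq> []" using q assms(5) by (auto simp: awalk_Nil_iff)
    moreover have "q \<noteq> [e]" for e
      using q assms(6) by (auto simp: awalk_Cons_iff awalk_Nil_iff)
    ultimately have "2 \<le> length q"
      by (cases q; cases "tl q") auto
    then show "2 \<le> ereal (awalk_cost (\<lambda>_. 1) q)" by (simp add: cost)
  qed
  ultimately show ?thesis by (rule antisym)
qed

text \<open>
  Lower bound: besides the labels themselves, each dominating vertex \<open>d\<close> blocks one further value
  next to its own label. The blocked value is taken on the side that faces the label of a fixed
  non-dominating vertex \<open>x\<close>; hence it stays between the minimum and the maximum, and no value is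
  blocked twice.
\<close>

lemma labeling_span_ge:
  assumes \<Gamma>: "pair_graph \<Gamma>" and x: "x \<in> pverts \<Gamma>" "x \<notin> Dom \<Gamma>" and ne: "Dom \<Gamma> \<noteq> {}"
    and f: "L21_labeling \<Gamma> f"
  shows "int (card (pverts \<Gamma>)) + int (card (Dom \<Gamma>)) - 1 \<le> labeling_span \<Gamma> f"
proof -
  interpret pair_graph \<Gamma> by (rule \<Gamma>)
  let ?V = "pverts \<Gamma>" and ?D = "Dom \<Gamma>"
  have DV: "?D \<subseteq> ?V" by (auto simp: Dom_def)
  have fin: "finite ?V" by simp
  have finD: "finite ?D" using DV fin finite_subset by blast
  have far: "\<bar>f d - f w\<bar> \<ge> 2" if "d \<in> ?D" "w \<in> ?V" "w \<noteq> d" for d w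
    using that f DV unfolding L21_labeling_def Dom_def by blast
  have inj: "inj_on f ?V"
  proof (rule inj_onI)
    fix u v assume uv: "u \<in> ?V" "v \<in> ?V" "f u = f v"
    show "u = v"
    proof (rule ccontr)
      assume "u \<noteq> v"
      then have "(u, v) \<in> parcs \<Gamma> \<or> graph_dist \<Gamma> u v = 2"
        using graph_dist_eq_2[OF \<Gamma>] ne uv by blast
      then have "\<bar>f u - f v\<bar> \<ge> 1" using f uv unfolding L21_labeling_def by force
      then show False using uv by simp
    qed
  qed
  define s where "s d = (if f d < f x then f d + 1 else f d - 1)" for d
  have x_far: "f d < f x - 1 \<or> f x + 1 < f d" if "d \<in> ?D" for d
  proof -
    have "x \<noteq> d" using x(2) that by auto
    then show ?thesis using far[OF that x(1)] by linarith
  qed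
  have injs: "inj_on s ?D"
  proof (rule inj_onI)
    fix d d' assume d: "d \<in> ?D" "d' \<in> ?D" "s d = s d'"
    then show "d = d'"
      using far[of d d'] x_far[of d] x_far[of d'] DV
      by (auto simp: s_def split: if_splits)
  qed
  have disj: "f ` ?V \<inter> s ` ?D = {}"
  proof -
    have "f w \<noteq> s d" if "w \<in> ?V" "d \<in> ?D" for w d
      using far[OF that(2,1)] by (cases "w = d") (auto simp: s_def)
    then show ?thesis by blast
  qed
  let ?M = "Max (f ` ?V)" and ?m = "Min (f ` ?V)"
  have bounds: "?m \<le> f w" "f w \<le> ?M" if "w \<in> ?V" for w
    using that fin by auto
  have "f ` ?V \<union> s ` ?D \<subseteq> {?m..?M}"
  proof -
    have "s d \<in> {?m..?M}" if "d \<in> ?D" for d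
    proof -
      have "d \<in> ?V" using that DV by blast
      then show ?thesis
        using bounds[of d] bounds[OF x(1)] x_far[OF that]
        unfolding s_def atLeastAtMost_iff by (cases "f d < f x"; simp only: if_True if_False; linarith)
    qed
    then show ?thesis using bounds by auto
  qed
  then have "card (f ` ?V \<union> s ` ?D) \<le> card {?m..?M}" by (intro card_mono) auto
  also have "card (f ` ?V \<union> s ` ?D) = card ?V + card ?D"
    using card_Un_disjoint[OF _ _ disj] fin finD card_image[OF inj] card_image[OF injs] by simp
  finally show ?thesis
    using bounds[OF x(1)] by (simp add: labeling_span_def)
qed

text \<open>
  Upper bound: number the vertices outside \<open>Dom \<Gamma>\<close> by \<open>0, \<dots>, k - 1\<close> along a Hamiltonian path of
  the complement, and the dominating vertices by \<open>k + 1, k + 3, k + 5, \<dots>\<close>.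
\<close>

lemma labeling_from_path:
  assumes \<Gamma>: "pair_graph \<Gamma>" and ne: "Dom \<Gamma> \<noteq> {}" "pverts \<Gamma> \<noteq> Dom \<Gamma>"
    and h: "bij_betw h {..<card (pverts \<Gamma> - Dom \<Gamma>)} (pverts \<Gamma> - Dom \<Gamma>)"
      "\<And>j. Suc j < card (pverts \<Gamma> - Dom \<Gamma>) \<Longrightarrow> (h j, h (Suc j)) \<notin> parcs \<Gamma>"
  shows "\<exists>f. L21_labeling \<Gamma> f \<and>
           labeling_span \<Gamma> f = int (card (pverts \<Gamma>)) + int (card (Dom \<Gamma>)) - 1"
proof -
  interpret pair_graph \<Gamma> by (rule \<Gamma>)
  let ?V = "pverts \<Gamma>" and ?D = "Dom \<Gamma>"
  define k where "k = card (?V - ?D)"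
  have DV: "?D \<subseteq> ?V" by (auto simp: Dom_def)
  have fin: "finite ?V" by simp
  have finD: "finite ?D" using DV fin finite_subset by blast
  have sym: "(y, x) \<in> parcs \<Gamma>" if "(x, y) \<in> parcs \<Gamma>" for x y
    using that arcs_symmetric by blast
  have kpos: "k > 0" using ne DV fin by (auto simp: k_def card_gt_0_iff)
  obtain g where g: "bij_betw g ?D {..<card ?D}"
    using ex_bij_betw_finite_nat[OF finD] by (auto simp: atLeast0LessThan)
  define i where "i = the_inv_into {..<k} h"
  have i: "bij_betw i (?V - ?D) {..<k}" "\<And>v. v \<in> ?V - ?D \<Longrightarrow> h (i v) = v"
    using h(1) bij_betw_the_inv_into[OF h(1)] f_the_inv_into_f_bij_betw[OF h(1)]
    by (auto simp: i_def k_def)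
  define f :: "'a \<Rightarrow> int" where "f v = (if v \<in> ?D then int (k + 1 + 2 * g v) else int (i v))" for v
  have i_less: "i v < k" if "v \<in> ?V - ?D" for v using i(1) that by (auto simp: bij_betw_def)
  have g_less: "g v < card ?D" if "v \<in> ?D" for v using g that by (auto simp: bij_betw_def)
  have dist: "f u \<noteq> f v \<and> ((u, v) \<in> parcs \<Gamma> \<longrightarrow> \<bar>f u - f v\<bar> \<ge> 2)"
    if uv: "u \<in> ?V" "v \<in> ?V" "u \<noteq> v" for u v
  proof -
    consider "u \<in> ?D" "v \<in> ?D" | "u \<in> ?D" "v \<notin> ?D" | "u \<notin> ?D" "v \<in> ?D" | "u \<notin> ?D" "v \<notin> ?D"
      by blast
    then show ?thesis
    proof cases
      case 1
      then have "g u \<noteq> g v" using g uv by (auto simp: bij_betw_def dest: inj_onD)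
      then show ?thesis using 1 by (auto simp: f_def)
    next
      case 2
      then show ?thesis using i_less[of v] uv by (simp add: f_def)
    next
      case 3
      then show ?thesis using i_less[of u] uv by (simp add: f_def)
    next
      case 4
      then have ne: "i u \<noteq> i v" using i(2)[of u] i(2)[of v] uv by auto
      have "i v \<noteq> Suc (i u)" "i u \<noteq> Suc (i v)" if "(u, v) \<in> parcs \<Gamma>"
        using h(2)[of "i u"] h(2)[of "i v"] i(2)[of u] i(2)[of v] i_less[of u] i_less[of v]
          4 uv that sym[OF that] by (auto simp: k_def)
      then show ?thesis using ne 4 by (auto simp: f_def)
    qed
  qed
  have "L21_labeling \<Gamma> f"
    unfolding L21_labeling_def
  proof (intro ballI conjI impI)
    fix u v assume uv: "u \<in> ?V" "v \<in> ?V"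
    { assume a: "(u, v) \<in> parcs \<Gamma>"
      then have "u \<noteq> v" using no_loops[of "(u, v)"] by auto
      then show "\<bar>f u - f v\<bar> \<ge> 2" using dist uv a by blast }
    { assume "graph_dist \<Gamma> u v = 2"
      then have "u \<noteq> v" using graph_dist_refl[OF \<Gamma> uv(1)] by auto
      then show "\<bar>f u - f v\<bar> \<ge> 1" using dist[OF uv] by linarith }
  qed
  moreover have "labeling_span \<Gamma> f = int (card ?V) + int (card ?D) - 1"
  proof -
    have cV: "card ?V = k + card ?D"
      using DV finD fin by (simp add: k_def card_Diff_subset card_mono)
    have "h 0 \<in> ?V - ?D" using h(1) kpos by (auto simp: bij_betw_def k_def)
    moreover have "i (h 0) = 0"
      unfolding i_def using h(1) kpos by (intro the_inv_into_f_f) (auto simp: bij_betw_def k_def)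
    ultimately have "0 \<in> f ` ?V" by (intro image_eqI[of _ _ "h 0"]) (auto simp: f_def)
    then have "Min (f ` ?V) = 0" using fin by (intro Min_eqI) (auto simp: f_def)
    moreover have "Max (f ` ?V) = int (k + 1 + 2 * (card ?D - 1))"
    proof (rule Max_eqI)
      have "card ?D > 0" using ne finD by (simp add: card_gt_0_iff)
      then have "card ?D - 1 \<in> g ` ?D" using g by (simp add: bij_betw_def)
      then obtain d where "d \<in> ?D" "g d = card ?D - 1" by auto
      then show "int (k + 1 + 2 * (card ?D - 1)) \<in> f ` ?V"
        using DV by (intro image_eqI[of _ _ d]) (auto simp: f_def)
    next
      fix y assume "y \<in> f ` ?V"
      then obtain v where v: "v \<in> ?V" "y = f v" by blast
      show "y \<le> int (k + 1 + 2 * (card ?D - 1))"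
        using g_less[of v] i_less[of v] v by (auto simp: f_def)
    qed (use fin in simp)
    moreover have "card ?D > 0" using ne finD by (simp add: card_gt_0_iff)
    ultimately show ?thesis using cV by (simp add: labeling_span_def of_nat_diff)
  qed
  ultimately show ?thesis by blast
qed

lemma lambda_number_eq:
  assumes "pair_graph \<Gamma>" "Dom \<Gamma> \<noteq> {}" "pverts \<Gamma> \<noteq> Dom \<Gamma>"
    and "bij_betw h {..<card (pverts \<Gamma> - Dom \<Gamma>)} (pverts \<Gamma> - Dom \<Gamma>)"
      "\<And>j. Suc j < card (pverts \<Gamma> - Dom \<Gamma>) \<Longrightarrow> (h j, h (Suc j)) \<notin> parcs \<Gamma>"
  shows "lambda_number \<Gamma> = int (card (pverts \<Gamma>)) + int (card (Dom \<Gamma>)) - 1"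
  unfolding lambda_number_def
proof (rule Least_equality)
  show "\<exists>f. L21_labeling \<Gamma> f \<and> labeling_span \<Gamma> f = int (card (pverts \<Gamma>)) + int (card (Dom \<Gamma>)) - 1"
    using labeling_from_path[OF assms] .
next
  fix s assume "\<exists>f. L21_labeling \<Gamma> f \<and> labeling_span \<Gamma> f = s"
  moreover obtain x where "x \<in> pverts \<Gamma>" "x \<notin> Dom \<Gamma>" using assms(3) by (auto simp: Dom_def)
  ultimately show "int (card (pverts \<Gamma>)) + int (card (Dom \<Gamma>)) - 1 \<le> s"
    using labeling_span_ge[OF assms(1)] assms(2) by blast
qed

section \<open>Cyclic subgroups in groups with commuting coprime elements\<close>

text \<open>
  Finite groups in which elements of coprime order commute. These are exactly the finite nilpotent
  groups, but the commutation property is easier to transfer along products and isomorphisms. It is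
  stated with coprime exponents \<open>m\<close> and \<open>n\<close> that annihilate the two elements, in place of their
  orders.
\<close>

locale coprime_commuting_group = group G for G (structure) +
  assumes fin [simp]: "finite (carrier G)"
    and coprime_orders_commute:
      "\<lbrakk>x \<in> carrier G; y \<in> carrier G; coprime (m::nat) (n::nat); x [^] m = \<one>; y [^] n = \<one>\<rbrakk>
        \<Longrightarrow> x \<otimes> y = y \<otimes> x"
begin

abbreviation cyc :: "'a \<Rightarrow> 'a set" where
  "cyc x \<equiv> generate G {x}"

text \<open>
  The closed neighbourhood of \<open>x\<close> in the enhanced power graph: all \<open>y\<close> that share a cyclic subgroup
  with \<open>x\<close>.
\<close>

definition cobound :: "'a \<Rightarrow> 'a set" where
  "cobound x = {y \<in> carrier G. \<exists>z \<in> carrier G. x \<in> cyc z \<and> y \<in> cyc z}"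

text \<open>
  The neighbourhood of \<open>x\<close> in the complement of the enhanced power graph.
\<close>

definition apart :: "'a \<Rightarrow> 'a set" where
  "apart x = carrier G - cobound x"

text \<open>
  The vertices joined to all others in the enhanced power graph.
\<close>

definition dominating :: "'a set" where
  "dominating = {x \<in> carrier G. cobound x = carrier G}"

lemma cyc_iff: "x \<in> carrier G \<Longrightarrow> y \<in> cyc x \<longleftrightarrow> (\<exists>k::nat. y = x [^] k)"
  by (subst generate_pow_on_finite_carrier[OF fin]) blast+

lemma cyc_subgroup: "x \<in> carrier G \<Longrightarrow> subgroup (cyc x) G"
  by (rule generate_is_subgroup) simp

lemma cyc_closed: "\<lbrakk>x \<in> carrier G; y \<in> cyc x\<rbrakk> \<Longrightarrow> y \<in> carrier G"
  by (rule subgroup.mem_carrier[OF cyc_subgroup])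

lemma pow_in_cyc: "x \<in> carrier G \<Longrightarrow> x [^] (k::nat) \<in> cyc x"
  using cyc_iff by blast

lemma self_in_cyc: "x \<in> carrier G \<Longrightarrow> x \<in> cyc x"
  by (simp add: generate.incl)

lemma cyc_trans: "\<lbrakk>x \<in> carrier G; y \<in> cyc x; z \<in> cyc y\<rbrakk> \<Longrightarrow> z \<in> cyc x"
  by (metis cyc_closed cyc_iff nat_pow_pow)

lemma cyc_mono: "\<lbrakk>x \<in> carrier G; y \<in> cyc x\<rbrakk> \<Longrightarrow> cyc y \<subseteq> cyc x"
  using cyc_trans by blast

lemma cyc_mult: "\<lbrakk>x \<in> carrier G; y \<in> cyc x; z \<in> cyc x\<rbrakk> \<Longrightarrow> y \<otimes> z \<in> cyc x"
  by (rule generate.eng)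

lemma cyc_inv: "\<lbrakk>x \<in> carrier G; y \<in> cyc x\<rbrakk> \<Longrightarrow> inv y \<in> cyc x"
  by (rule subgroup.m_inv_closed[OF cyc_subgroup])

lemma cyc_cancel_right:
  assumes "x \<in> carrier G" "y \<in> carrier G" "z \<in> cyc x" "y \<otimes> z \<in> cyc x"
  shows "y \<in> cyc x"
proof -
  have "y = (y \<otimes> z) \<otimes> inv z"
    using assms cyc_closed by (simp add: m_assoc)
  then show ?thesis
    using assms cyc_mult cyc_inv by metis
qed

lemma pow_cong:
  assumes "x \<in> carrier G" "[k = l] (mod order G)"
  shows "x [^] (k::nat) = x [^] l"
proof -
  have "x [^] k = x [^] (k mod order G)" for k :: nat
  proof -
    have "x [^] k = x [^] (order G * (k div order G) + k mod order G)" by simp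
    also have "\<dots> = x [^] (k mod order G)"
      using assms(1) pow_order_eq_1[OF assms(1)]
      by (metis l_one nat_pow_closed nat_pow_mult nat_pow_one nat_pow_pow)
    finally show ?thesis .
  qed
  then show ?thesis using assms(2) by (metis cong_def)
qed

lemma cobound_subset: "cobound x \<subseteq> carrier G"
  by (auto simp: cobound_def)

lemma cobound_sym: "\<lbrakk>x \<in> carrier G; y \<in> cobound x\<rbrakk> \<Longrightarrow> x \<in> cobound y"
  by (auto simp: cobound_def)

lemma cobound_refl: "x \<in> carrier G \<Longrightarrow> x \<in> cobound x"
  using self_in_cyc by (auto simp: cobound_def)

lemma cobound_commute: "\<lbrakk>x \<in> carrier G; y \<in> cobound x\<rbrakk> \<Longrightarrow> x \<otimes> y = y \<otimes> x"
  by (auto simp: cobound_def cyc_iff nat_pow_mult add.commute)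

lemma cobound_antimono:
  "\<lbrakk>x \<in> carrier G; x' \<in> cyc x\<rbrakk> \<Longrightarrow> cobound x \<subseteq> cobound x'"
  using cyc_trans unfolding cobound_def by blast

lemma cobound_mult_iff:
  assumes "x \<in> carrier G" "y \<in> carrier G" "x' \<in> cyc x"
  shows "y \<otimes> x' \<in> cobound x \<longleftrightarrow> y \<in> cobound x"
proof
  assume "y \<otimes> x' \<in> cobound x"
  then obtain z where z: "z \<in> carrier G" "x \<in> cyc z" "y \<otimes> x' \<in> cyc z"
    by (auto simp: cobound_def)
  then have "x' \<in> cyc z" using cyc_trans assms by blast
  then show "y \<in> cobound x"
    using z cyc_cancel_right assms unfolding cobound_def by blast
next
  assume "y \<in> cobound x"
  then obtain z where z: "z \<in> carrier G" "x \<in> cyc z" "y \<in> cyc z"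
    by (auto simp: cobound_def)
  then have "x' \<in> cyc z" using cyc_trans assms by blast
  then show "y \<otimes> x' \<in> cobound x"
    using z cyc_mult assms cyc_closed unfolding cobound_def by blast
qed

lemma apart_subset: "apart x \<subseteq> carrier G"
  by (auto simp: apart_def)

lemma card_apart: "x \<in> carrier G \<Longrightarrow> card (cobound x) + card (apart x) = order G"
  unfolding apart_def order_def
  by (metis card_Diff_subset card_mono cobound_subset fin finite_subset le_add_diff_inverse)

lemma apart_mono: "\<lbrakk>x \<in> carrier G; x' \<in> cyc x\<rbrakk> \<Longrightarrow> apart x' \<subseteq> apart x"
  using cobound_antimono by (auto simp: apart_def)

lemma dominating_iff: "x \<in> dominating \<longleftrightarrow> x \<in> carrier G \<and> apart x = {}"
  using cobound_subset by (auto simp: dominating_def apart_def)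

lemma one_dominating: "\<one> \<in> dominating"
  by (auto simp: dominating_def cobound_def intro: self_in_cyc generate.one)

lemma dominating_cyc: "\<lbrakk>x \<in> dominating; y \<in> cyc x\<rbrakk> \<Longrightarrow> y \<in> dominating"
  unfolding dominating_iff using apart_mono cyc_closed by blast

lemma dominating_mult:
  assumes "x \<in> dominating" "y \<in> dominating"
  shows "x \<otimes> y \<in> dominating"
proof -
  have "w \<in> cobound (x \<otimes> y)" if w: "w \<in> carrier G" for w
  proof -
    have "w \<in> cobound x" using assms w by (auto simp: dominating_def)
    then obtain z where z: "z \<in> carrier G" "x \<in> cyc z" "w \<in> cyc z"
      by (auto simp: cobound_def)
    have "z \<in> cobound y" using assms z by (auto simp: dominating_def)
    then obtain v where v: "v \<in> carrier G" "y \<in> cyc v" "z \<in> cyc v"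
      by (auto simp: cobound_def)
    then show ?thesis using z w cyc_trans cyc_mult unfolding cobound_def by blast
  qed
  then show ?thesis using assms cobound_subset by (auto simp: dominating_def)
qed

lemma apart_imp_not_dominating:
  assumes "x \<in> carrier G" "y \<in> apart x" shows "x \<notin> dominating" "y \<notin> dominating" "y \<noteq> x"
  using assms cobound_sym cobound_refl by (auto simp: apart_def dominating_def)

text \<open>
  Vertices that share a cyclic subgroup commute, so a vertex whose closed neighbourhood contains more
  than half of the group has a centralizer of index less than 2.
\<close>

lemma central_if_few_apart:
  assumes x: "x \<in> carrier G" "2 * card (apart x) < order G" and y: "y \<in> carrier G"
  shows "x \<otimes> y = y \<otimes> x"
proof -
  define C where "C = {w \<in> carrier G. x \<otimes> w = w \<otimes> x}"
  have sub: "subgroup C G"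
  proof (rule subgroupI)
    show "C \<subseteq> carrier G" "C \<noteq> {}" using x by (auto simp: C_def)
  next
    fix a assume "a \<in> C"
    then have a: "a \<in> carrier G" "x \<otimes> a = a \<otimes> x" by (auto simp: C_def)
    have "x = a \<otimes> x \<otimes> inv a"
      using a x by (metis inv_solve_right m_closed)
    then have "inv a \<otimes> x = x \<otimes> inv a"
      using a x by (metis inv_closed inv_solve_left m_assoc m_closed)
    then show "inv a \<in> C" using a by (simp add: C_def)
  next
    fix a b assume "a \<in> C" "b \<in> C"
    then show "a \<otimes> b \<in> C" using x by (auto simp: C_def) (metis m_assoc)
  qed
  have "cobound x \<subseteq> C"
    using cobound_commute cobound_subset x by (auto simp: C_def)
  then have "card (cobound x) \<le> card C"
    by (intro card_mono) (auto simp: C_def)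
  then have "order G < 2 * card C" using card_apart[OF x(1)] x(2) by linarith
  moreover have "card C dvd order G" using lagrange[OF sub] by (metis dvd_triv_right)
  then obtain k where k: "order G = card C * k" by blast
  ultimately have "k < 2" by (metis mult.commute mult_less_cancel1)
  moreover have "k \<noteq> 0" using k order_gt_0_iff_finite by auto
  ultimately have "card C = order G" using k by (simp add: less_2_cases_iff)
  then have "C = carrier G"
    unfolding order_def using card_subset_eq[OF fin, of C] by (auto simp: C_def)
  then show ?thesis using y by (auto simp: C_def)
qed

end

section \<open>The p-part of an element\<close>

text \<open>
  Fix a prime \<open>p\<close> and write the group order as \<open>p ^ a * m\<close> with \<open>m\<close> prime to \<open>p\<close>. By the Chinese
  remainder theorem there are exponents \<open>e\<close> and \<open>f\<close> with \<open>e \<equiv> 1\<close>, \<open>f \<equiv> 0\<close> modulo \<open>p ^ a\<close> and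
  \<open>e \<equiv> 0\<close>, \<open>f \<equiv> 1\<close> modulo \<open>m\<close>; then \<open>x ^ e\<close> and \<open>x ^ f\<close> are the \<open>p\<close>-part and the \<open>p'\<close>-part of
  every element \<open>x\<close> simultaneously. The exponent \<open>a\<close> may be \<open>0\<close>.
\<close>

locale p_part = coprime_commuting_group +
  fixes p a m e f :: nat
  assumes p: "prime p"
    and ord_eq: "order G = p ^ a * m" and cop: "coprime p m"
    and e_dvd: "m dvd e" and f_dvd: "p ^ a dvd f"
    and ef: "[e + f = 1] (mod order G)"
begin

text \<open>
  The \<open>p\<close>-part of an element. The \<open>p\<close>-elements are the fixed points of \<open>pp\<close>.
\<close>

definition pp :: "'a \<Rightarrow> 'a" where "pp x = x [^] e"

text \<open>
  The \<open>p'\<close>-part of an element.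
\<close>

definition pc :: "'a \<Rightarrow> 'a" where "pc x = x [^] f"

lemma pp_closed [simp]: "x \<in> carrier G \<Longrightarrow> pp x \<in> carrier G"
  by (simp add: pp_def)

lemma pc_closed [simp]: "x \<in> carrier G \<Longrightarrow> pc x \<in> carrier G"
  by (simp add: pc_def)

lemma pp_in_cyc: "x \<in> carrier G \<Longrightarrow> pp x \<in> cyc x"
  by (simp add: pp_def pow_in_cyc)

lemma pc_in_cyc: "x \<in> carrier G \<Longrightarrow> pc x \<in> cyc x"
  by (simp add: pc_def pow_in_cyc)

lemma pp_pc: "x \<in> carrier G \<Longrightarrow> pp x \<otimes> pc x = x"
  using pow_cong[OF _ ef] by (simp add: pp_def pc_def nat_pow_mult)

lemma pp_pp [simp]:
  assumes "x \<in> carrier G" shows "pp (pp x) = pp x"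
proof -
  have "[e * (e + f) = e * 1] (mod order G)"
    using ef by (rule cong_scalar_left)
  moreover have "order G dvd e * f"
    using e_dvd f_dvd by (metis mult.commute mult_dvd_mono ord_eq)
  ultimately have "[e * e = e] (mod order G)"
    by (metis cong_0_iff cong_add_lcancel_0_nat cong_trans cong_sym distrib_left mult.right_neutral)
  then show ?thesis using assms pow_cong by (simp add: pp_def nat_pow_pow)
qed

lemma pp_pc_one [simp]:
  assumes "x \<in> carrier G" shows "pp (pc x) = \<one>"
proof -
  have "order G dvd f * e"
    using e_dvd f_dvd by (metis mult_dvd_mono ord_eq)
  then have "[f * e = 0] (mod order G)" by (simp add: cong_0_iff)
  then have "x [^] (f * e) = x [^] (0::nat)" by (rule pow_cong[OF assms])
  then show ?thesis using assms by (simp add: pp_def pc_def nat_pow_pow)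
qed

lemma pp_mult:
  "\<lbrakk>x \<in> carrier G; y \<in> carrier G; x \<otimes> y = y \<otimes> x\<rbrakk> \<Longrightarrow> pp (x \<otimes> y) = pp x \<otimes> pp y"
  unfolding pp_def by (rule pow_mult_distrib)

lemma pp_pow: "x \<in> carrier G \<Longrightarrow> pp (x [^] (k::nat)) = pp x [^] k"
  by (simp add: pp_def nat_pow_pow mult.commute)

lemma pp_cyc: "\<lbrakk>x \<in> carrier G; pp x = x; y \<in> cyc x\<rbrakk> \<Longrightarrow> pp y = y"
  by (auto simp: cyc_iff pp_pow)

lemma pp_pow_card:
  assumes "x \<in> carrier G" shows "pp x [^] (p ^ a) = \<one>"
proof -
  have "[e * p ^ a = 0] (mod order G)"
    using e_dvd by (simp add: cong_0_iff ord_eq mult.commute)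
  then have "x [^] (e * p ^ a) = x [^] (0::nat)" by (rule pow_cong[OF assms])
  then show ?thesis using assms by (simp add: pp_def nat_pow_pow)
qed

lemma pc_pow_card:
  assumes "x \<in> carrier G" shows "pc x [^] m = \<one>"
proof -
  have "[f * m = 0] (mod order G)"
    using f_dvd by (simp add: cong_0_iff ord_eq)
  then have "x [^] (f * m) = x [^] (0::nat)" by (rule pow_cong[OF assms])
  then show ?thesis using assms by (simp add: pc_def nat_pow_pow)
qed

lemma pp_pc_commute:
  assumes "x \<in> carrier G" "y \<in> carrier G"
  shows "pp x \<otimes> pc y = pc y \<otimes> pp x"
proof (rule coprime_orders_commute)
  show "coprime (p ^ a) m" using cop by simp
qed (use assms pp_pow_card pc_pow_card in auto)

lemma pp_mult_pc:
  assumes "x \<in> carrier G" "y \<in> carrier G"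
  shows "pp (pp x \<otimes> pc y) = pp x"
  using assms by (simp add: pp_mult pp_pc_commute)

text \<open>
  Whether \<open>y\<close> shares a cyclic subgroup with a \<open>p\<close>-element depends only on the \<open>p\<close>-part of \<open>y\<close>: a
  generator for the \<open>p\<close>-part can be multiplied by the commuting \<open>p'\<close>-part of \<open>y\<close>.
\<close>

lemma cobound_pp_iff:
  assumes c: "c \<in> carrier G" "pp c = c" and y: "y \<in> carrier G"
  shows "pp y \<in> cobound c \<longleftrightarrow> y \<in> cobound c"
proof
  assume "y \<in> cobound c"
  then have "c \<in> cobound y" by (rule cobound_sym[OF c(1)])
  then have "c \<in> cobound (pp y)"
    using cobound_antimono[OF y pp_in_cyc[OF y]] by blast
  then show "pp y \<in> cobound c" by (rule cobound_sym[OF pp_closed[OF y]])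
next
  assume "pp y \<in> cobound c"
  then obtain z where z: "z \<in> carrier G" "c \<in> cyc z" "pp y \<in> cyc z"
    by (auto simp: cobound_def)
  have *: "pp w \<in> cyc (pp z)" if "w \<in> cyc z" for w
    using that z pp_pow pow_in_cyc by (auto simp: cyc_iff)
  define v where "v = pp z \<otimes> pc y"
  have v: "v \<in> carrier G" using z y by (simp add: v_def)
  have ppv: "pp v = pp z" using z y by (simp add: v_def pp_mult_pc)
  then have zv: "pp z \<in> cyc v" using pp_in_cyc[OF v] by simp
  have "v = pp z \<otimes> pc v" using ppv pp_pc[OF v] by simp
  then have "pp z \<otimes> pc y = pp z \<otimes> pc v" by (simp add: v_def)
  then have "pc y = pc v" using z v y by simp
  then have "pc y \<in> cyc v" using pc_in_cyc[OF v] by simp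
  moreover have "pp y \<in> cyc v" "c \<in> cyc v"
    using *[OF z(2)] *[OF z(3)] zv cyc_trans[OF v] c y by auto
  ultimately have "y \<in> cyc v"
    using cyc_mult[OF v] pp_pc[OF y] by metis
  then show "y \<in> cobound c" using v \<open>c \<in> cyc v\<close> y by (auto simp: cobound_def)
qed

text \<open>
  The \<open>p\<close>-elements of a cyclic group generate a chain of subgroups.
\<close>

lemma cyc_pp_comparable:
  assumes z: "z \<in> carrier G" and cd: "c \<in> cyc z" "d \<in> cyc z" "pp c = c" "pp d = d"
  shows "c \<in> cyc d \<or> d \<in> cyc c"
proof -
  have *: "\<exists>k. c = pp z [^] (k::nat)" if "c \<in> cyc z" "pp c = c" for c
    using that z pp_pow by (auto simp: cyc_iff) metis
  obtain i j :: nat where ij: "c = pp z [^] i" "d = pp z [^] j"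
    using *[of c] *[of d] cd by blast
  \<comment> \<open>every power \<open>u ^ i\<close> of a \<open>p\<close>-element \<open>u\<close> generates the same subgroup as
    \<open>u ^ gcd i (p ^ a)\<close>, and the latter exponents are powers of \<open>p\<close>\<close>
  have gen: "pp z [^] gcd i (p ^ a) \<in> cyc (pp z [^] i)" for i :: nat
  proof (cases "i = 0")
    case True
    then show ?thesis using pp_pow_card[OF z] by (simp add: generate.one)
  next
    case False
    obtain x y where xy: "i * x = p ^ a * y + gcd i (p ^ a)"
      using bezout_nat[OF False] by blast
    have "pp z [^] (i * x) = pp z [^] gcd i (p ^ a)"
      using z pp_pow_card[OF z]
      by (simp add: xy flip: nat_pow_mult nat_pow_pow)
    then show ?thesis
      using z pow_in_cyc[of "pp z [^] i" x] by (simp add: nat_pow_pow)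
  qed
  have le: "pp z [^] j \<in> cyc (pp z [^] i)" if "gcd i (p ^ a) dvd gcd j (p ^ a)" for i j :: nat
  proof -
    have "gcd i (p ^ a) dvd j" using that by auto
    then obtain k where "j = gcd i (p ^ a) * k" by blast
    then have "pp z [^] j = (pp z [^] gcd i (p ^ a)) [^] k"
      using z by (simp add: nat_pow_pow)
    then have "pp z [^] j \<in> cyc (pp z [^] gcd i (p ^ a))"
      using z pow_in_cyc by simp
    then show ?thesis using cyc_trans gen z nat_pow_closed pp_closed by blast
  qed
  obtain s where s: "gcd i (p ^ a) = p ^ s"
    using divides_primepow_nat[OF p] by (metis gcd_dvd2)
  obtain t where t: "gcd j (p ^ a) = p ^ t"
    using divides_primepow_nat[OF p] by (metis gcd_dvd2)
  have "p ^ s dvd p ^ t \<or> p ^ t dvd p ^ s"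
    by (meson le_imp_power_dvd nle_le)
  then show ?thesis using le ij s t by metis
qed

lemma cobound_pp_comparable:
  assumes "c \<in> carrier G" "pp c = c" "d \<in> cobound c" "pp d = d"
  shows "c \<in> cyc d \<or> d \<in> cyc c"
  using assms cyc_pp_comparable unfolding cobound_def by blast

end

section \<open>Elements of small complement degree\<close>

context p_part
begin

text \<open>
  For a \<open>p\<close>-element \<open>c\<close>, the neighbourhood \<open>cobound c\<close> is covered by two sets: the elements whose
  \<open>p\<close>-part is a power of \<open>c\<close>, called \<open>over c\<close>, and the elements of which \<open>c\<close> is a power, called
  \<open>above c\<close>.
\<close>

definition over :: "'a \<Rightarrow> 'a set" where
  "over c = {w \<in> carrier G. pp w \<in> cyc c}"

definition above :: "'a \<Rightarrow> 'a set" where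
  "above c = {w \<in> carrier G. c \<in> cyc w}"

lemma over_subset: "over c \<subseteq> carrier G"
  by (auto simp: over_def)

lemma finite_over [simp]: "finite (over c)"
  using over_subset finite_subset fin by blast

lemma above_subset: "above c \<subseteq> carrier G"
  by (auto simp: above_def)

lemma finite_above [simp]: "finite (above c)"
  using above_subset finite_subset fin by blast

lemma central_cyc:
  assumes c: "c \<in> carrier G" "\<And>y. y \<in> carrier G \<Longrightarrow> c \<otimes> y = y \<otimes> c"
    and d: "d \<in> cyc c" and y: "y \<in> carrier G"
  shows "d \<otimes> y = y \<otimes> d"
proof -
  have "c [^] k \<otimes> y = y \<otimes> c [^] k" for k :: nat
  proof (induction k)
    case (Suc k)
    have "c [^] Suc k \<otimes> y = c [^] k \<otimes> (y \<otimes> c)" using c y by (simp add: m_assoc)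
    also have "\<dots> = y \<otimes> c [^] Suc k" using c y Suc by (simp flip: m_assoc)
    finally show ?case .
  qed (use y in simp)
  then show ?thesis using d c(1) by (auto simp: cyc_iff)
qed

lemma pp_mult_over:
  assumes c: "c \<in> carrier G" "pp c = c" "\<And>y. y \<in> carrier G \<Longrightarrow> c \<otimes> y = y \<otimes> c"
    and y: "y \<in> carrier G" "pp y = y" and w: "w \<in> over c"
  shows "pp (y \<otimes> w) = y \<otimes> pp w"
proof -
  have w': "w \<in> carrier G" "pp w \<in> cyc c" using w by (auto simp: over_def)
  define u where "u = y \<otimes> pp w"
  have u: "u \<in> carrier G" using y w' by (simp add: u_def)
  have "pp w \<otimes> y = y \<otimes> pp w" using central_cyc[OF c(1,3)] w' y by blast
  then have ppu: "pp u = u" using y w' by (simp add: u_def pp_mult)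
  have "y \<otimes> w = pp u \<otimes> pc w"
    using pp_pc[OF w'(1)] y w' by (simp add: ppu) (simp add: u_def m_assoc)
  then have "pp (y \<otimes> w) = pp u" using pp_mult_pc[OF u w'(1)] by simp
  then show ?thesis using ppu u_def by simp
qed

text \<open>
  Multiplication by a \<open>p\<close>-element \<open>y\<close> of \<open>apart c\<close> maps \<open>over c\<close> injectively into \<open>apart c\<close>.
\<close>

lemma card_over_le_card_apart:
  assumes c: "c \<in> carrier G" "pp c = c" "\<And>y. y \<in> carrier G \<Longrightarrow> c \<otimes> y = y \<otimes> c"
    and nd: "c \<notin> dominating"
  shows "card (over c) \<le> card (apart c)"
proof -
  obtain y0 where y0: "y0 \<in> apart c" using nd c dominating_iff by auto
  define y where "y = pp y0"
  have y: "y \<in> carrier G" "pp y = y" "y \<notin> cobound c"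
    using y0 cobound_pp_iff[OF c(1,2)] by (auto simp: y_def apart_def)
  have "(\<otimes>) y ` over c \<subseteq> apart c"
  proof
    fix v assume "v \<in> (\<otimes>) y ` over c"
    then obtain w where w: "w \<in> over c" "v = y \<otimes> w" by auto
    then have w': "w \<in> carrier G" "pp w \<in> cyc c" by (auto simp: over_def)
    have "pp v \<notin> cobound c"
      using pp_mult_over[OF c y(1,2) w(1)] cobound_mult_iff[OF c(1) y(1) w'(2)] y w by simp
    then show "v \<in> apart c" using cobound_pp_iff[OF c(1,2)] w w' y by (auto simp: apart_def)
  qed
  moreover have "inj_on ((\<otimes>) y) (over c)"
    by (rule inj_on_subset[OF inj_on_cmult[OF y(1)] over_subset])
  ultimately show ?thesis
    using card_inj_on_le[of "(\<otimes>) y"] finite_subset[OF apart_subset fin] by blast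
qed

text \<open>
  A set that contains with \<open>w\<close> all elements whose \<open>p\<close>-part lies in the coset of \<open>pp w\<close> modulo the
  powers of \<open>c\<close> is a disjoint union of translates of \<open>over c\<close>.
\<close>

lemma card_over_dvd:
  assumes c: "c \<in> carrier G" "pp c = c" "\<And>y. y \<in> carrier G \<Longrightarrow> c \<otimes> y = y \<otimes> c"
    and A: "A \<subseteq> carrier G"
    and closed: "\<And>w v d. \<lbrakk>w \<in> A; v \<in> carrier G; d \<in> cyc c; pp v = pp w \<otimes> d\<rbrakk> \<Longrightarrow> v \<in> A"
  shows "card (over c) dvd card A"
proof -
  define r where "r = {(w, v). w \<in> A \<and> v \<in> A \<and> (\<exists>d \<in> cyc c. pp v = pp w \<otimes> d)}"
  have Ac: "w \<in> carrier G" if "w \<in> A" for w using A that by blast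
  have cc: "d \<in> carrier G" if "d \<in> cyc c" for d using that c cyc_closed by blast
  have "equiv A r"
  proof (rule equivI)
    show "r \<subseteq> A \<times> A" by (auto simp: r_def)
    show "refl_on A r"
    proof (rule refl_onI)
      fix w assume w: "w \<in> A"
      have "pp w = pp w \<otimes> \<one>" using Ac[OF w] by simp
      then show "(w, w) \<in> r" using w generate.one[of G] by (auto simp: r_def)
    qed
    show "sym r"
    proof (rule symI)
      fix w v assume "(w, v) \<in> r"
      then obtain d where d: "w \<in> A" "v \<in> A" "d \<in> cyc c" "pp v = pp w \<otimes> d" by (auto simp: r_def)
      then have "pp w = pp v \<otimes> inv d" using Ac cc by (simp add: m_assoc)
      then show "(v, w) \<in> r" using d cyc_inv[OF c(1)] by (auto simp: r_def)
    qed
    show "trans r"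
    proof (rule transI)
      fix w v u assume "(w, v) \<in> r" "(v, u) \<in> r"
      then obtain d d' where d: "w \<in> A" "v \<in> A" "d \<in> cyc c" "pp v = pp w \<otimes> d"
        "u \<in> A" "d' \<in> cyc c" "pp u = pp v \<otimes> d'" by (auto simp: r_def)
      then have "pp u = pp w \<otimes> (d \<otimes> d')" using Ac cc by (simp add: m_assoc)
      then show "(w, u) \<in> r" using d cyc_mult[OF c(1)] by (auto simp: r_def)
    qed
  qed
  moreover have "card (over c) dvd card X" if "X \<in> A // r" for X
  proof -
    from that obtain w where w: "w \<in> A" "X = r `` {w}" by (auto elim: quotientE)
    have ppw: "pp w \<in> carrier G" "pp (pp w) = pp w" using Ac[OF w(1)] by auto
    have "bij_betw ((\<otimes>) (pp w)) (over c) X"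
    proof (rule bij_betw_imageI)
      show "inj_on ((\<otimes>) (pp w)) (over c)"
        by (rule inj_on_subset[OF inj_on_cmult[OF ppw(1)] over_subset])
      show "(\<otimes>) (pp w) ` over c = X"
      proof (intro equalityI subsetI)
        fix v assume "v \<in> (\<otimes>) (pp w) ` over c"
        then obtain t where t: "t \<in> over c" "v = pp w \<otimes> t" by auto
        have "pp v = pp w \<otimes> pp t" using pp_mult_over[OF c ppw t(1)] t(2) by simp
        moreover have "v \<in> carrier G" "pp t \<in> cyc c" using t ppw by (auto simp: over_def)
        ultimately show "v \<in> X" using closed w by (auto simp: r_def)
      next
        fix v assume "v \<in> X"
        then obtain d where d: "v \<in> A" "d \<in> cyc c" "pp v = pp w \<otimes> d" using w by (auto simp: r_def)
        have dc: "d \<in> carrier G" "pp d = d" using cc[OF d(2)] pp_cyc[OF c(1,2) d(2)] by auto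
        define t where "t = d \<otimes> pc v"
        have "pp t = d" using pp_mult_pc[of d v] dc Ac[OF d(1)] by (simp add: t_def)
        then have "t \<in> over c" using d dc Ac by (simp add: over_def t_def)
        moreover have "pp w \<otimes> t = v"
          using d(3) pp_pc[OF Ac[OF d(1)]] dc ppw Ac[OF d(1)] by (simp add: t_def flip: m_assoc)
        ultimately show "v \<in> (\<otimes>) (pp w) ` over c" by auto
      qed
    qed
    then show ?thesis by (simp add: bij_betw_same_card)
  qed
  ultimately show ?thesis using equiv_imp_dvd_card[OF finite_subset[OF A fin]] by blast
qed

text \<open>
  If \<open>apart c\<close> is smaller than half of the group, divisibility by the size of \<open>over c\<close> gives
  \<open>order G - 2 * card (apart c) \<ge> card (over c)\<close>. As at most half of \<open>over c\<close> lies outside \<open>above c\<close>,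
  at least half of the group lies in \<open>above c\<close>.
\<close>

lemma half_above:
  assumes c: "c \<in> carrier G" "pp c = c" and few: "2 * card (apart c) < order G"
  shows "order G \<le> 2 * card (above c)"
proof -
  have cen: "\<And>y. y \<in> carrier G \<Longrightarrow> c \<otimes> y = y \<otimes> c"
    using central_if_few_apart[OF c(1) few] .
  have "card (over c) dvd order G"
    unfolding order_def by (rule card_over_dvd[OF c cen]) auto
  moreover have "card (over c) dvd card (apart c)"
  proof (rule card_over_dvd[OF c cen])
    fix w v d assume *: "w \<in> apart c" "v \<in> carrier G" "d \<in> cyc c" "pp v = pp w \<otimes> d"
    then have "w \<in> carrier G" "w \<notin> cobound c" by (auto simp: apart_def)
    then have "pp w \<otimes> d \<notin> cobound c"
      using cobound_pp_iff[OF c] cobound_mult_iff[OF c(1) _ *(3)] by simp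
    then have "v \<notin> cobound c"
      using cobound_pp_iff[OF c *(2)] by (simp only: *(4) not_False_eq_True)
    then show "v \<in> apart c" using *(2) by (simp add: apart_def)
  qed (auto simp: apart_subset)
  ultimately have "card (over c) dvd order G - 2 * card (apart c)" by simp
  then have gap: "2 * card (apart c) + card (over c) \<le> order G"
    using few by (auto dest: dvd_imp_le)
  \<comment> \<open>for \<open>w\<close> in \<open>over c\<close>, at least one of \<open>w\<close> and \<open>c \<otimes> w\<close> lies above \<open>c\<close>\<close>
  have "(\<otimes>) c ` (over c - above c) \<subseteq> over c \<inter> above c"
  proof
    fix v assume "v \<in> (\<otimes>) c ` (over c - above c)"
    then obtain w where w: "w \<in> over c" "c \<notin> cyc w" "v = c \<otimes> w"
      by (auto simp: above_def over_def)
    then have w': "w \<in> carrier G" "pp w \<in> cyc c" by (auto simp: over_def)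
    have ppv: "pp v = c \<otimes> pp w" using pp_mult_over[OF c cen c] w by simp
    have v: "v \<in> carrier G" "pp v \<in> cyc c"
      using w w' c ppv cyc_mult[OF c(1)] self_in_cyc by auto
    have "c \<in> cyc v"
    proof -
      consider "pp w \<in> cyc (pp v)" | "pp v \<in> cyc (pp w)"
        using cyc_pp_comparable[OF c(1) w'(2) v(2)] w' v by auto
      then show ?thesis
      proof cases
        case 1
        have "c \<in> cyc (pp v)"
          by (rule cyc_cancel_right[OF _ c(1) 1]) (use v w' c self_in_cyc[of "pp v"] ppv in auto)
        then show ?thesis using cyc_trans[OF v(1) pp_in_cyc[OF v(1)]] by simp
      next
        case 2
        have "c \<in> cyc (pp w)"
          by (rule cyc_cancel_right[OF _ c(1), of _ "pp w"])
             (use w' 2 self_in_cyc[of "pp w"] ppv in auto)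
        then show ?thesis
          using cyc_trans[OF w'(1) pp_in_cyc[OF w'(1)]] w(2) by simp
      qed
    qed
    then show "v \<in> over c \<inter> above c" using v by (simp add: over_def above_def)
  qed
  moreover have "inj_on ((\<otimes>) c) (over c - above c)"
    by (rule inj_on_subset[OF inj_on_cmult[OF c(1)]]) (use over_subset in blast)
  ultimately have "card (over c - above c) \<le> card (over c \<inter> above c)"
    by (intro card_inj_on_le[of "(\<otimes>) c"]) auto
  moreover have "card (over c) = card (over c \<inter> above c) + card (over c - above c)"
    by (metis card_Int_Diff finite_over)
  ultimately have le: "2 * card (over c - above c) \<le> card (over c)" by linarith
  have "cobound c \<subseteq> above c \<union> (over c - above c)"
  proof
    fix w assume w: "w \<in> cobound c"
    then have wc: "w \<in> carrier G" "pp w \<in> cobound c"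
      using cobound_subset cobound_pp_iff[OF c] by auto
    then have "c \<in> cyc (pp w) \<or> pp w \<in> cyc c"
      using cobound_pp_comparable[OF c] by simp
    then show "w \<in> above c \<union> (over c - above c)"
      using wc cyc_trans[OF wc(1) pp_in_cyc[OF wc(1)]] by (auto simp: over_def above_def)
  qed
  then have "card (cobound c) \<le> card (above c) + card (over c - above c)"
    by (metis card_Un_le card_mono finite_Diff finite_Un finite_above finite_over le_trans)
  then show ?thesis using card_apart[OF c(1)] gap le by linarith
qed

text \<open>
  Two sets \<open>above c\<close> and \<open>above d\<close> of at least half the group size would partition the group if they
  were disjoint. But for non-dominating \<open>c\<close> and \<open>d\<close> neither contains the identity, so they
  meet, and \<open>c\<close> and \<open>d\<close> are powers of a common element.
\<close>

lemma few_apart_comparable: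
  assumes c: "c \<in> carrier G" "pp c = c" "2 * card (apart c) < order G"
    and d: "d \<in> carrier G" "pp d = d" "2 * card (apart d) < order G"
  shows "c \<in> cyc d \<or> d \<in> cyc c"
proof -
  have "d \<in> cobound c"
  proof (cases "c \<in> dominating \<or> d \<in> dominating")
    case True
    then show ?thesis using c d cobound_sym by (auto simp: dominating_def)
  next
    case False
    have "above c \<inter> above d \<noteq> {}"
    proof
      assume disj: "above c \<inter> above d = {}"
      have "\<one> \<notin> above c \<union> above d"
        using False one_dominating dominating_cyc by (auto simp: above_def)
      then have "above c \<union> above d \<subset> carrier G" using above_subset by blast
      then have "card (above c \<union> above d) < order G"
        unfolding order_def by (rule psubset_card_mono[OF fin])
      then have "card (above c) + card (above d) < order G"
        using card_Un_disjoint[OF _ _ disj] by simp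
      then show False using half_above[OF c] half_above[OF d] by linarith
    qed
    then show ?thesis using c d by (auto simp: above_def cobound_def)
  qed
  then show ?thesis using cobound_pp_comparable c d by blast
qed

text \<open>
  The \<open>p\<close>-parts of the vertices of complement degree at most \<open>k\<close> form a chain. If \<open>c\<close> generates the
  largest member of that chain, all these vertices lie in \<open>over c\<close>, whose size is at most
  \<open>card (apart c) \<le> k\<close>.
\<close>

lemma card_few_apart_le:
  assumes x: "x \<in> carrier G" "pp x \<notin> dominating" "card (apart x) \<le> k" and k: "2 * k < order G"
  shows "card {y \<in> carrier G. card (apart y) \<le> k} \<le> k"
proof -
  define S where "S = {y \<in> carrier G. card (apart y) \<le> k}"
  have xS: "x \<in> S" and finS: "finite S" using x by (auto simp: S_def)
  have pS: "pp y \<in> S" "2 * card (apart (pp y)) < order G" if "y \<in> S" for y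
  proof -
    have "card (apart (pp y)) \<le> card (apart y)"
      using that apart_mono pp_in_cyc finite_subset[OF apart_subset fin]
      by (intro card_mono) (auto simp: S_def)
    then show "pp y \<in> S" "2 * card (apart (pp y)) < order G"
      using that k by (auto simp: S_def)
  qed
  have "finite ((\<lambda>y. card (cyc (pp y))) ` S)" "(\<lambda>y. card (cyc (pp y))) ` S \<noteq> {}"
    using finS xS by auto
  from Max_in[OF this] obtain y where y: "y \<in> S"
    "card (cyc (pp y)) = Max ((\<lambda>y. card (cyc (pp y))) ` S)" by auto
  have max: "card (cyc (pp z)) \<le> card (cyc (pp y))" if "z \<in> S" for z
    unfolding y(2) using that finS by (intro Max_ge) auto
  define c where "c = pp y"
  have c: "c \<in> carrier G" "pp c = c" "c \<in> S" "2 * card (apart c) < order G"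
    using y pS by (auto simp: c_def S_def)
  have sub: "pp z \<in> cyc c" if "z \<in> S" for z
  proof -
    have z: "pp z \<in> carrier G" "pp (pp z) = pp z" using that by (auto simp: S_def)
    from few_apart_comparable[OF z pS(2)[OF that] c(1,2,4)]
    show ?thesis
    proof
      assume *: "c \<in> cyc (pp z)"
      then have "cyc c \<subseteq> cyc (pp z)" using cyc_mono z by blast
      moreover have "finite (cyc (pp z))"
        using finite_subset[OF _ fin] z cyc_closed by blast
      ultimately have "cyc c = cyc (pp z)"
        using card_seteq max[OF that] unfolding c_def by blast
      then show ?thesis using self_in_cyc z by blast
    qed
  qed
  have nd: "c \<notin> dominating" using sub[OF xS] x(2) dominating_cyc by blast
  have "S \<subseteq> over c" using sub by (auto simp: over_def S_def)
  then have "card S \<le> card (over c)" by (intro card_mono) auto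
  also have "\<dots> \<le> card (apart c)"
    using card_over_le_card_apart[OF c(1,2) central_if_few_apart[OF c(1,4)] nd] .
  also have "\<dots> \<le> k" using c(3) by (simp add: S_def)
  finally show ?thesis by (simp add: S_def)
qed

end

context coprime_commuting_group
begin

lemma dominating_inv: "x \<in> dominating \<Longrightarrow> inv x \<in> dominating"
  using dominating_cyc cyc_inv self_in_cyc by (meson dominating_iff)

text \<open>
  Some \<open>p\<close>-part of a non-dominating element is non-dominating. As the dominating elements form a
  subgroup, the exponents \<open>i\<close> with \<open>x ^ i\<close> dominating are the multiples of some \<open>d \<noteq> 1\<close>, and any
  prime divisor \<open>p\<close> of \<open>d\<close> will do, since the exponent that extracts the \<open>p\<close>-part is prime to \<open>p\<close>.
\<close>

lemma exists_nondominating_p_part: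
  assumes x: "x \<in> carrier G" "x \<notin> dominating"
  obtains p a m e f where "p_part G p a m e f" "x [^] e \<notin> dominating"
proof -
  have gt: "order G > 0" by (simp add: order_gt_0_iff_finite)
  define d where "d = (LEAST d::nat. d > 0 \<and> x [^] d \<in> dominating)"
  have ex: "order G > 0 \<and> x [^] order G \<in> dominating"
    using gt pow_order_eq_1[OF x(1)] one_dominating by simp
  have d: "d > 0" "x [^] d \<in> dominating"
    using LeastI[of "\<lambda>d::nat. d > 0 \<and> x [^] d \<in> dominating", OF ex] by (auto simp: d_def)
  have least: "r = 0" if "r < d" "x [^] r \<in> dominating" for r :: nat
    using not_less_Least[of r "\<lambda>d::nat. d > 0 \<and> x [^] d \<in> dominating"] that by (auto simp: d_def)
  have d_dvd: "d dvd i" if i: "x [^] i \<in> dominating" for i :: nat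
  proof -
    define u where "u = x [^] (d * (i div d))"
    have "u \<in> cyc (x [^] d)"
      using pow_in_cyc[of "x [^] d" "i div d"] x by (simp add: u_def nat_pow_pow)
    then have u: "u \<in> dominating" using dominating_cyc d by blast
    have uc: "u \<in> carrier G" using x by (simp add: u_def)
    have "x [^] (i mod d) \<otimes> u = x [^] i"
      using x by (simp add: u_def nat_pow_mult)
    then have "x [^] (i mod d) = x [^] i \<otimes> inv u"
      using x uc by (metis inv_solve_right nat_pow_closed)
    then have "x [^] (i mod d) \<in> dominating"
      using dominating_mult dominating_inv i u by simp
    then have "i mod d = 0" by (rule least[rotated]) (use d(1) in simp)
    then show ?thesis by (rule mod_0_imp_dvd)
  qed
  have "d \<noteq> 1" using d x by auto
  then obtain p where p: "prime p" "p dvd d" using prime_factor_nat by blast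
  have p_dvd: "p dvd order G" using d_dvd[of "order G"] ex p dvd_trans by blast
  obtain m where m: "order G = p ^ multiplicity p (order G) * m" "\<not> p dvd m"
    using multiplicity_decompose'[of "order G" p] gt p by (metis not_prime_unit not_gr_zero)
  define a where "a = multiplicity p (order G)"
  have cop: "coprime p m" using m p prime_imp_coprime by blast
  then have cop': "coprime (p ^ a) m" by simp
  obtain e where e: "[e = 1] (mod p ^ a)" "[e = 0] (mod m)"
    using binary_chinese_remainder_nat[OF cop'] by blast
  obtain f where f: "[f = 0] (mod p ^ a)" "[f = 1] (mod m)"
    using binary_chinese_remainder_nat[OF cop'] by blast
  have "[e + f = 1] (mod p ^ a)" using cong_add[OF e(1) f(1)] by simp
  moreover have "[e + f = 1] (mod m)" using cong_add[OF e(2) f(2)] by simp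
  ultimately have "[e + f = 1] (mod (p ^ a * m))"
    using coprime_cong_mult_nat cop' by blast
  then have "p_part G p a m e f"
    using p cop e f m by unfold_locales (auto simp: a_def cong_0_iff)
  moreover have "x [^] e \<notin> dominating"
  proof
    assume "x [^] e \<in> dominating"
    then have "p dvd e" using d_dvd p dvd_trans by blast
    moreover have "p dvd p ^ a"
      using p_dvd m cop p by (metis a_def coprime_dvd_mult_left_iff)
    then have "[e = 1] (mod p)" using e(1) cong_dvd_modulus_nat by blast
    ultimately have "p dvd 1" using cong_dvd_iff by blast
    then show False using p by simp
  qed
  ultimately show ?thesis using that by blast
qed

text \<open>
  The degree condition of Posa's theorem for the complement of the enhanced power graph. It is strict
  because the identity has no neighbour in the complement and is dominating.
\<close>

lemma card_few_apart_less:
  assumes x: "x \<in> carrier G" "x \<notin> dominating" "card (apart x) \<le> k" and k: "2 * k < order G"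
  shows "card {y \<in> carrier G - dominating. card (apart y) \<le> k} < k"
proof -
  obtain p a m e f where pe: "p_part G p a m e f" and nd: "x [^] e \<notin> dominating"
    using exists_nondominating_p_part[OF x(1,2)] .
  interpret p_part G p a m e f by (rule pe)
  let ?S = "{y \<in> carrier G. card (apart y) \<le> k}"
  have "card ?S \<le> k"
    using card_few_apart_le[OF x(1) _ x(3) k] nd by (simp add: pp_def)
  moreover have "\<one> \<in> ?S" using one_dominating by (simp add: dominating_iff)
  then have "{y \<in> carrier G - dominating. card (apart y) \<le> k} \<subset> ?S"
    using one_dominating by blast
  then have "card {y \<in> carrier G - dominating. card (apart y) \<le> k} < card ?S"
    by (rule psubset_card_mono[rotated]) simp
  ultimately show ?thesis by linarith
qed

lemma card_nondominating_ge_3: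
  assumes x: "x \<in> carrier G" "x \<notin> dominating"
  shows "3 \<le> card (carrier G - dominating)"
proof -
  obtain y where y: "y \<in> apart x" using x dominating_iff by auto
  then have yc: "y \<in> carrier G" "y \<notin> dominating" "y \<noteq> x"
    using apart_subset apart_imp_not_dominating[OF x(1) y] by auto
  have "x \<otimes> y \<notin> cobound y"
    using cobound_mult_iff[OF yc(1) x(1) self_in_cyc[OF yc(1)]] cobound_sym[OF yc(1)] y
    by (auto simp: apart_def)
  then have nd: "x \<otimes> y \<notin> dominating"
    using cobound_sym[of "x \<otimes> y" y] x yc by (auto simp: dominating_def)
  have "x \<otimes> y \<noteq> x" "x \<otimes> y \<noteq> y"
    using x yc one_dominating by (auto simp: r_cancel_one' l_cancel_one')
  \<comment> \<open>For \<open>x\<close> and \<open>y\<close> without a common cyclic subgroup, \<open>x\<close>, \<open>y\<close> and \<open>x \<otimes> y\<close> are distinct and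
    not dominating.\<close>
  then have "card {x, y, x \<otimes> y} = 3" using yc by auto
  moreover have "{x, y, x \<otimes> y} \<subseteq> carrier G - dominating" using x yc nd by auto
  ultimately show ?thesis by (metis card_mono fin finite_Diff)
qed

text \<open>
  If all elements are dominating, an element of largest order generates the group.
\<close>

lemma cyclic_if_all_dominating:
  assumes "dominating = carrier G"
  shows "cyclic_group G"
proof -
  have "finite ((\<lambda>y. card (cyc y)) ` carrier G)" "(\<lambda>y. card (cyc y)) ` carrier G \<noteq> {}"
    using one_closed by auto
  from Max_in[OF this] obtain z where z: "z \<in> carrier G"
    "card (cyc z) = Max ((\<lambda>y. card (cyc y)) ` carrier G)" by auto
  have max: "card (cyc y) \<le> card (cyc z)" if "y \<in> carrier G" for y
    unfolding z(2) using that by (intro Max_ge) auto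
  have "y \<in> cyc z" if y: "y \<in> carrier G" for y
  proof -
    have "y \<in> cobound z" using assms z y by (auto simp: dominating_def)
    then obtain v where v: "v \<in> carrier G" "z \<in> cyc v" "y \<in> cyc v" by (auto simp: cobound_def)
    have "finite (cyc v)" using finite_subset[OF _ fin] v cyc_closed by blast
    then have "cyc z = cyc v"
      using card_seteq[of "cyc v" "cyc z"] max[OF v(1)] cyc_mono[OF v(1,2)] by blast
    then show ?thesis using v by simp
  qed
  then have "carrier G = cyc z" using cyc_closed z by blast
  then have "subgroup_generated G {z} = G"
    using z by (simp add: subgroup_generated_def)
  then show ?thesis using z unfolding cyclic_group_def by blast
qed

end

section \<open>The labeling number of the enhanced power graph\<close>

context coprime_commuting_group
begin

lemma parcs_enhanced_power_graph:
  "(x, y) \<in> parcs (enhanced_power_graph G) \<longleftrightarrow> x \<in> carrier G \<and> y \<noteq> x \<and> y \<in> cobound x"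
  by (auto simp: enhanced_power_graph_def cobound_def)

lemma Dom_enhanced_power_graph: "Dom (enhanced_power_graph G) = dominating"
proof -
  have "v \<in> Dom (enhanced_power_graph G) \<longleftrightarrow> v \<in> dominating" for v
    using cobound_subset[of v] cobound_refl[of v]
    unfolding Dom_def dominating_def mem_Collect_eq parcs_enhanced_power_graph
    by (auto simp: enhanced_power_graph_def)
  then show ?thesis by blast
qed

theorem lambda_number_enhanced_power_graph:
  assumes "\<not> cyclic_group G"
  shows "lambda_number (enhanced_power_graph G)
         = int (order G) + int (card (Dom (enhanced_power_graph G))) - 1"
proof -
  let ?\<Gamma> = "enhanced_power_graph G"
  define V where "V = carrier G - dominating"
  \<comment> \<open>adjacency in the complement of the enhanced power graph\<close>
  define R where "R x y \<longleftrightarrow> x \<in> carrier G \<and> y \<in> apart x" for x y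
  have verts: "pverts ?\<Gamma> = carrier G" by (simp add: enhanced_power_graph_def)
  have ne: "dominating \<noteq> carrier G" using cyclic_if_all_dominating assms by blast
  then obtain x0 where x0: "x0 \<in> carrier G" "x0 \<notin> dominating"
    by (auto simp: dominating_def)
  have finV: "finite V" by (simp add: V_def)
  have deg: "degree_in V R x = card (apart x)" if "x \<in> V" for x
  proof -
    have "{y \<in> V. R x y} = apart x"
      using that apart_subset apart_imp_not_dominating(2) by (auto simp: V_def R_def)
    then show ?thesis by (simp add: degree_in_def)
  qed
  have "\<exists>h. bij_betw h {..<card V} V \<and> (\<forall>j<card V. R (h j) (h (Suc j mod card V)))"
  proof (rule posa_hamiltonian_cycle[OF finV])
    show "3 \<le> card V" using card_nondominating_ge_3[OF x0] by (simp add: V_def)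
  next
    fix x y assume "R x y"
    then show "R y x" using cobound_sym by (auto simp: R_def apart_def)
  next
    fix x show "\<not> R x x" using cobound_refl by (auto simp: R_def apart_def)
  next
    fix x k assume x: "x \<in> V" "degree_in V R x \<le> k" "2 * k < card V"
    have "card V \<le> order G" unfolding order_def V_def by (rule card_mono) auto
    then have "card {y \<in> V. card (apart y) \<le> k} < k"
      using card_few_apart_less[of x k] x deg[OF x(1)] by (simp add: V_def)
    moreover have "{y \<in> V. degree_in V R y \<le> k} = {y \<in> V. card (apart y) \<le> k}"
      using deg by auto
    ultimately show "card {y \<in> V. degree_in V R y \<le> k} < k" by simp
  qed
  then obtain h where h: "bij_betw h {..<card V} V"
    "\<And>j. j < card V \<Longrightarrow> R (h j) (h (Suc j mod card V))" by blast
  have "lambda_number ?\<Gamma> = int (card (pverts ?\<Gamma>)) + int (card (Dom ?\<Gamma>)) - 1"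
  proof (rule lambda_number_eq)
    show "pair_graph ?\<Gamma>" by (rule pair_graph_enhanced_power_graph) simp
    show "Dom ?\<Gamma> \<noteq> {}" using one_dominating by (auto simp: Dom_enhanced_power_graph)
    show "pverts ?\<Gamma> \<noteq> Dom ?\<Gamma>" using ne by (simp add: verts Dom_enhanced_power_graph)
    show "bij_betw h {..<card (pverts ?\<Gamma> - Dom ?\<Gamma>)} (pverts ?\<Gamma> - Dom ?\<Gamma>)"
      using h(1) by (simp add: verts Dom_enhanced_power_graph V_def)
  next
    fix j assume "Suc j < card (pverts ?\<Gamma> - Dom ?\<Gamma>)"
    then have "R (h j) (h (Suc j))"
      using h(2)[of j] by (simp add: verts Dom_enhanced_power_graph V_def)
    then show "(h j, h (Suc j)) \<notin> parcs ?\<Gamma>"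
      by (simp add: parcs_enhanced_power_graph R_def apart_def)
  qed
  then show ?thesis by (simp add: verts order_def)
qed

end

section \<open>Groups in which coprime elements commute\<close>

lemma (in group) one_if_coprime_pows:
  assumes x: "x \<in> carrier G" "coprime (m::nat) (n::nat)" "x [^] m = \<one>" "x [^] n = \<one>"
  shows "x = \<one>"
proof -
  have "ord x dvd m" "ord x dvd n" using x pow_eq_id by auto
  then have "ord x = 1" using x(2) by (metis coprime_common_divisor_nat)
  then show ?thesis using x(1) ord_eq_1 by simp
qed

text \<open>
  If the commutator \<open>c\<close> of \<open>x\<close> and \<open>y\<close> commutes with both, then \<open>c ^ k\<close> is the commutator of \<open>x ^ k\<close>
  and \<open>y\<close>, and also that of \<open>x\<close> and \<open>y ^ k\<close>. So \<open>c\<close> is killed by every exponent that kills \<open>x\<close> or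
  \<open>y\<close>.
\<close>

lemma (in group) central_commutator_one:
  assumes x: "x \<in> carrier G" and y: "y \<in> carrier G" and c: "c \<in> carrier G"
    and xy: "x \<otimes> y = c \<otimes> (y \<otimes> x)"
    and cx: "c \<otimes> x = x \<otimes> c" and cy: "c \<otimes> y = y \<otimes> c"
    and mn: "coprime (m::nat) (n::nat)" "x [^] m = \<one>" "y [^] n = \<one>"
  shows "c = \<one>"
proof (rule one_if_coprime_pows[OF c mn(1)])
  have "x [^] k \<otimes> y = c [^] k \<otimes> (y \<otimes> x [^] k)" for k :: nat
  proof (induction k)
    case (Suc k)
    have "x [^] Suc k \<otimes> y = x [^] k \<otimes> (c \<otimes> (y \<otimes> x))"
      using x y xy by (simp add: m_assoc)
    also have "\<dots> = (x [^] k \<otimes> c) \<otimes> (y \<otimes> x)" using x y c by (simp add: m_assoc)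
    also have "x [^] k \<otimes> c = c \<otimes> x [^] k"
      using x c cx group_commutes_pow by metis
    also have "(c \<otimes> x [^] k) \<otimes> (y \<otimes> x) = c \<otimes> ((x [^] k \<otimes> y) \<otimes> x)"
      using x y c by (simp add: m_assoc)
    also have "\<dots> = c \<otimes> c [^] k \<otimes> (y \<otimes> x [^] Suc k)"
      using x y c Suc by (simp add: m_assoc)
    also have "c \<otimes> c [^] k = c [^] Suc k" using c nat_pow_Suc2 by simp
    finally show ?case .
  qed (use y in simp)
  from this[of m] show "c [^] m = \<one>" using x y c mn by simp
  have "x \<otimes> y [^] k = c [^] k \<otimes> (y [^] k \<otimes> x)" for k :: nat
  proof (induction k)
    case (Suc k)
    have "x \<otimes> y [^] Suc k = (x \<otimes> y [^] k) \<otimes> y"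
      using x y by (simp add: m_assoc)
    also have "\<dots> = c [^] k \<otimes> (y [^] k \<otimes> (c \<otimes> (y \<otimes> x)))" using x y c xy Suc by (simp add: m_assoc)
    also have "\<dots> = c [^] k \<otimes> ((y [^] k \<otimes> c) \<otimes> (y \<otimes> x))" using x y c by (simp add: m_assoc)
    also have "y [^] k \<otimes> c = c \<otimes> y [^] k"
      using y c cy group_commutes_pow by metis
    also have "c [^] k \<otimes> ((c \<otimes> y [^] k) \<otimes> (y \<otimes> x)) = c [^] Suc k \<otimes> (y [^] Suc k \<otimes> x)"
      using x y c by (simp add: m_assoc)
    finally show ?case .
  qed (use x in simp)
  from this[of n] show "c [^] n = \<one>" using x y c mn by simp
qed

lemma (in group) normal_lower_central_series: "lower_central_series G i \<lhd> G"
proof (induction i)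
  case 0
  then show ?case by (simp add: normal_invI subgroup_self)
next
  case (Suc i)
  then interpret N: normal "lower_central_series G i" G .
  show ?case unfolding lower_central_series.simps
  proof (rule normal_generateI)
    show "(\<Union>x\<in>lower_central_series G i. \<Union>y\<in>carrier G. {x \<otimes> y \<otimes> inv x \<otimes> inv y}) \<subseteq> carrier G"
      using N.subset by auto
  next
    fix h g assume h: "h \<in> (\<Union>x\<in>lower_central_series G i. \<Union>y\<in>carrier G. {x \<otimes> y \<otimes> inv x \<otimes> inv y})"
      and g: "g \<in> carrier G"
    then obtain x y where xy: "x \<in> lower_central_series G i" "y \<in> carrier G"
      "h = x \<otimes> y \<otimes> inv x \<otimes> inv y" by blast
    define x' y' where "x' = g \<otimes> x \<otimes> inv g" and "y' = g \<otimes> y \<otimes> inv g"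
    have xc: "x \<in> carrier G" using xy N.subset by blast
    have can: "inv g \<otimes> (g \<otimes> z) = z" if "z \<in> carrier G" for z
      using g that by (simp flip: m_assoc)
    have "g \<otimes> h \<otimes> inv g = x' \<otimes> y' \<otimes> inv x' \<otimes> inv y'"
      using xc xy g by (simp add: x'_def y'_def m_assoc inv_mult_group can)
    moreover have "x' \<in> lower_central_series G i" "y' \<in> carrier G"
      using N.inv_op_closed2 xy g by (auto simp: x'_def y'_def)
    ultimately show "g \<otimes> h \<otimes> inv g \<in> (\<Union>x\<in>lower_central_series G i. \<Union>y\<in>carrier G. {x \<otimes> y \<otimes> inv x \<otimes> inv y})"
      by blast
  qed
qed

lemma (in group) commutator_mult:
  assumes "x \<in> carrier G" "y \<in> carrier G"
  shows "(x \<otimes> y \<otimes> inv x \<otimes> inv y) \<otimes> (y \<otimes> x) = x \<otimes> y"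
proof -
  have "inv x \<otimes> (inv y \<otimes> (y \<otimes> x)) = \<one>"
    using assms by (simp flip: m_assoc)
  then show ?thesis using assms by (simp add: m_assoc)
qed

text \<open>
  Modulo the next term of the lower central series, a commutator in the \<open>i\<close>-th term is central, so
  \<open>central_commutator_one\<close> applies in the quotient.
\<close>

lemma (in group) coprime_commutator_in_lower_central_series:
  assumes x: "x \<in> carrier G" and y: "y \<in> carrier G"
    and mn: "coprime (m::nat) (n::nat)" "x [^] m = \<one>" "y [^] n = \<one>"
  shows "x \<otimes> y \<otimes> inv x \<otimes> inv y \<in> lower_central_series G i"
proof (induction i)
  case 0
  then show ?case using x y by simp
next
  case (Suc i)
  let ?N = "lower_central_series G (Suc i)"
  define c where "c = x \<otimes> y \<otimes> inv x \<otimes> inv y"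
  have c: "c \<in> carrier G" "c \<in> lower_central_series G i" using x y Suc by (auto simp: c_def)
  interpret N: normal ?N G by (rule normal_lower_central_series)
  interpret Q: group "G Mod ?N" by (rule N.factorgroup_is_group)
  let ?q = "\<lambda>g. ?N #> g"
  have q: "?q \<in> hom G (G Mod ?N)" by (rule N.r_coset_hom_Mod)
  have qm: "?q (g \<otimes> h) = ?q g \<otimes>\<^bsub>G Mod ?N\<^esub> ?q h" if "g \<in> carrier G" "h \<in> carrier G" for g h
    using hom_mult[OF q that] .
  have qc: "?q g \<in> carrier (G Mod ?N)" if "g \<in> carrier G" for g
    using hom_in_carrier[OF q that] .
  have q1: "?q g = \<one>\<^bsub>G Mod ?N\<^esub> \<longleftrightarrow> g \<in> ?N" if "g \<in> carrier G" for g
    using that N.subgroup_axioms coset_join1 coset_join2 by (metis one_FactGroup N.subset)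
  have qp: "?q (g [^] k) = ?q g [^]\<^bsub>G Mod ?N\<^esub> k" if "g \<in> carrier G" for g and k :: nat
    using that q Q.group_axioms by (metis group_hom.hom_nat_pow group_hom.intro group_hom_axioms.intro is_group)
  have cen: "?q c \<otimes>\<^bsub>G Mod ?N\<^esub> ?q g = ?q g \<otimes>\<^bsub>G Mod ?N\<^esub> ?q c" if g: "g \<in> carrier G" for g
  proof -
    have mem: "c \<otimes> g \<otimes> inv c \<otimes> inv g \<in> ?N"
      unfolding lower_central_series.simps using c g by (intro generate.incl) blast
    have "c \<otimes> g = (c \<otimes> g \<otimes> inv c \<otimes> inv g) \<otimes> (g \<otimes> c)"
      using commutator_mult[OF c(1) g] by (rule sym)
    then have "?q (c \<otimes> g) = \<one>\<^bsub>G Mod ?N\<^esub> \<otimes>\<^bsub>G Mod ?N\<^esub> ?q (g \<otimes> c)"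
      using qm[of "c \<otimes> g \<otimes> inv c \<otimes> inv g" "g \<otimes> c"] q1 mem c g
      by (metis inv_closed m_closed)
    then show ?thesis
      using qm[of c g] qm[of g c] Q.l_one[OF qc[of "g \<otimes> c"]] c g by (metis m_closed)
  qed
  have "x \<otimes> y = c \<otimes> (y \<otimes> x)"
    unfolding c_def using commutator_mult[OF x y] by (rule sym)
  then have "?q x \<otimes>\<^bsub>G Mod ?N\<^esub> ?q y = ?q c \<otimes>\<^bsub>G Mod ?N\<^esub> (?q y \<otimes>\<^bsub>G Mod ?N\<^esub> ?q x)"
    using qm[OF x y] qm[OF c(1) m_closed[OF y x]] qm[OF y x] by metis
  moreover have "?q x [^]\<^bsub>G Mod ?N\<^esub> m = \<one>\<^bsub>G Mod ?N\<^esub>" "?q y [^]\<^bsub>G Mod ?N\<^esub> n = \<one>\<^bsub>G Mod ?N\<^esub>"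
    using qp[OF x, of m] qp[OF y, of n] mn q1[OF one_closed] N.one_closed by simp_all
  ultimately have "?q c = \<one>\<^bsub>G Mod ?N\<^esub>"
    by (intro Q.central_commutator_one[OF qc[OF x] qc[OF y] qc[OF c(1)] _ cen[OF x] cen[OF y] mn(1)])
  then show ?case using q1 c by (simp add: c_def)
qed

lemma coprime_commuting_nilpotent:
  assumes "nilpotent_group G" "finite (carrier G)"
  shows "coprime_commuting_group G"
proof -
  interpret group G using assms by (simp add: nilpotent_group_def)
  obtain k where k: "lower_central_series G k = {\<one>\<^bsub>G\<^esub>}"
    using assms by (auto simp: nilpotent_group_def)
  show ?thesis
  proof
    fix x y and m n :: nat
    assume *: "x \<in> carrier G" "y \<in> carrier G" "coprime m n"
      "x [^]\<^bsub>G\<^esub> m = \<one>\<^bsub>G\<^esub>" "y [^]\<^bsub>G\<^esub> n = \<one>\<^bsub>G\<^esub>"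
    have "x \<otimes>\<^bsub>G\<^esub> y \<otimes>\<^bsub>G\<^esub> inv\<^bsub>G\<^esub> x \<otimes>\<^bsub>G\<^esub> inv\<^bsub>G\<^esub> y = \<one>\<^bsub>G\<^esub>"
      using coprime_commutator_in_lower_central_series[OF *, of k] k by simp
    then have "x \<otimes>\<^bsub>G\<^esub> y \<otimes>\<^bsub>G\<^esub> inv\<^bsub>G\<^esub> x = y"
      using * by (metis inv_closed inv_equality inv_inv m_closed)
    then show "x \<otimes>\<^bsub>G\<^esub> y = y \<otimes>\<^bsub>G\<^esub> x"
      using * by (metis inv_solve_right m_closed)
  qed (rule assms(2))
qed

lemma coprime_commuting_p_group:
  assumes "prime p" "finite_p_group p G"
  shows "coprime_commuting_group G"
proof -
  interpret group G using assms by (simp add: finite_p_group_def)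
  obtain k where k: "order G = p ^ k" using assms by (auto simp: finite_p_group_def)
  have triv: "x = \<one>\<^bsub>G\<^esub>" if "x \<in> carrier G" "\<not> p dvd m" "x [^]\<^bsub>G\<^esub> m = \<one>\<^bsub>G\<^esub>" for x and m :: nat
  proof (rule one_if_coprime_pows[OF that(1) _ that(3)])
    show "coprime m (p ^ k)"
      using that(2) assms(1) by (metis coprime_commute coprime_power_right_iff prime_imp_coprime)
    show "x [^]\<^bsub>G\<^esub> (p ^ k) = \<one>\<^bsub>G\<^esub>" using pow_order_eq_1[OF that(1)] k by simp
  qed
  show ?thesis
  proof
    fix x y and m n :: nat
    assume *: "x \<in> carrier G" "y \<in> carrier G" "coprime m n"
      "x [^]\<^bsub>G\<^esub> m = \<one>\<^bsub>G\<^esub>" "y [^]\<^bsub>G\<^esub> n = \<one>\<^bsub>G\<^esub>"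
    \<comment> \<open>one of two coprime exponents is prime to \<open>p\<close>, and the element it annihilates is trivial\<close>
    then have "\<not> p dvd m \<or> \<not> p dvd n"
      using assms(1) by (meson coprime_common_divisor not_prime_unit)
    then have "x = \<one>\<^bsub>G\<^esub> \<or> y = \<one>\<^bsub>G\<^esub>" using triv * by blast
    then show "x \<otimes>\<^bsub>G\<^esub> y = y \<otimes>\<^bsub>G\<^esub> x" using * by auto
  qed (use assms in \<open>simp add: finite_p_group_def\<close>)
qed

lemma coprime_commuting_comm_group:
  assumes "comm_group G" "finite (carrier G)"
  shows "coprime_commuting_group G"
proof -
  interpret comm_group G by (rule assms(1))
  show ?thesis by unfold_locales (use assms(2) m_comm in auto)
qed

lemma coprime_commuting_DirProd:
  assumes "coprime_commuting_group G" "coprime_commuting_group H"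
  shows "coprime_commuting_group (G \<times>\<times> H)"
proof -
  interpret G: coprime_commuting_group G by (rule assms(1))
  interpret H: coprime_commuting_group H by (rule assms(2))
  interpret group "G \<times>\<times> H" by (rule DirProd_group) unfold_locales
  have pow: "z [^]\<^bsub>G \<times>\<times> H\<^esub> k = (fst z [^]\<^bsub>G\<^esub> k, snd z [^]\<^bsub>H\<^esub> k)" for z and k :: nat
    by (induction k) (auto simp: mult_DirProd')
  show ?thesis
  proof
    fix x y and m n :: nat
    assume "x \<in> carrier (G \<times>\<times> H)" "y \<in> carrier (G \<times>\<times> H)" "coprime m n"
      "x [^]\<^bsub>G \<times>\<times> H\<^esub> m = \<one>\<^bsub>G \<times>\<times> H\<^esub>" "y [^]\<^bsub>G \<times>\<times> H\<^esub> n = \<one>\<^bsub>G \<times>\<times> H\<^esub>"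
    then show "x \<otimes>\<^bsub>G \<times>\<times> H\<^esub> y = y \<otimes>\<^bsub>G \<times>\<times> H\<^esub> x"
      using G.coprime_orders_commute[of "fst x" "fst y" m n] H.coprime_orders_commute[of "snd x" "snd y" m n]
      by (auto simp: pow mult_DirProd')
  qed simp
qed

lemma coprime_commuting_iso:
  assumes "group G" "coprime_commuting_group H" "G \<cong> H"
  shows "coprime_commuting_group G"
proof -
  interpret G: group G by (rule assms(1))
  interpret H: coprime_commuting_group H by (rule assms(2))
  obtain h where h: "h \<in> iso G H" using assms(3) by (auto simp: is_iso_def)
  then interpret h: group_hom G H h by unfold_locales (simp add: iso_def)
  have bij: "bij_betw h (carrier G) (carrier H)" using h by (simp add: iso_def)
  show ?thesis
  proof
    show "finite (carrier G)" using bij_betw_finite[OF bij] H.fin by blast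
  next
    fix x y and m n :: nat
    assume *: "x \<in> carrier G" "y \<in> carrier G" "coprime m n"
      "x [^]\<^bsub>G\<^esub> m = \<one>\<^bsub>G\<^esub>" "y [^]\<^bsub>G\<^esub> n = \<one>\<^bsub>G\<^esub>"
    then have "h x [^]\<^bsub>H\<^esub> m = \<one>\<^bsub>H\<^esub>" "h y [^]\<^bsub>H\<^esub> n = \<one>\<^bsub>H\<^esub>"
      by (metis h.hom_nat_pow h.hom_one)+
    then have "h (x \<otimes>\<^bsub>G\<^esub> y) = h (y \<otimes>\<^bsub>G\<^esub> x)"
      using H.coprime_orders_commute[of "h x" "h y" m n] * by simp
    moreover have "inj_on h (carrier G)" using bij by (simp add: bij_betw_def)
    ultimately show "x \<otimes>\<^bsub>G\<^esub> y = y \<otimes>\<^bsub>G\<^esub> x"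
      using *(1,2) by (metis inj_onD G.m_closed)
  qed
qed

theorem theorem3p12:
  fixes G :: "'a monoid" and G' :: "'b monoid" and P :: "'c monoid" and n :: nat
  assumes "group G"
    and "nilpotent_group G'" and "finite (carrier G')" and "odd (order G')"
    and "no_cyclic_sylow G'"
    and "finite_p_group 2 P" and "\<not> cyclic_group P"
    and "n > 0" and "gcd n (order G') = 1" and "gcd 2 n = 1"
    and "G \<cong> G' \<times>\<times> P \<times>\<times> integer_mod_group n"
  shows "lambda_number (enhanced_power_graph G)
         = int (order G) + int (card (Dom (enhanced_power_graph G))) - 1"
proof -
  let ?H = "G' \<times>\<times> P \<times>\<times> integer_mod_group n"
  have grp: "group G'" "group P" using assms by (auto simp: nilpotent_group_def finite_p_group_def)
  have "coprime_commuting_group (integer_mod_group n)"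
    by (rule coprime_commuting_comm_group) (use assms(8) in \<open>auto simp: carrier_integer_mod_group\<close>)
  then have "coprime_commuting_group ?H"
    by (intro coprime_commuting_DirProd coprime_commuting_nilpotent[OF assms(2,3)]
        coprime_commuting_p_group[OF two_is_prime_nat assms(6)])
  then have G: "coprime_commuting_group G" using coprime_commuting_iso assms(1,11) by blast
  have gH: "group ?H" using grp by (intro DirProd_group) auto
  have "fst \<circ> snd \<in> epi ?H P"
  proof -
    have "p \<in> (fst \<circ> snd) ` carrier ?H" if "p \<in> carrier P" for p
      by (rule image_eqI[of _ _ "(\<one>\<^bsub>G'\<^esub>, p, 0)"])
         (use that grp in \<open>auto intro: monoid.one_closed group.is_monoid\<close>)
    then show ?thesis by (auto simp: epi_iff_subset hom_def)
  qed
  then have "\<not> cyclic_group ?H"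
    using group.cyclic_group_epimorphic_image[OF gH _ _ grp(2)] assms(7) by blast
  then have "\<not> cyclic_group G"
    using isomorphic_group_cyclicity[OF assms(11,1) gH] by blast
  then show ?thesis by (rule coprime_commuting_group.lambda_number_enhanced_power_graph[OF G])
qed

end
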